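(* Identify the orthogonal complement $V=\mathfrak{t}^2\times(\mathbb{O}\otimes e_1)^3$ of $\mathfrak{f}_4$ in $\mathfrak{e}_6$ with $\mathbb{R}^2\times\mathbb{O}^3$ as follows: $$(t,s,u,v,w)\mapsto (tL_{e_1}+sR_{e_1},\; u\otimes e_1,\; v\otimes e_1,\; w\otimes e_1).$$ Let $(A,u,v,w)\in\mathfrak{f}_4$ and $(t,s,x,y,z)\in V$. Then the Lie bracket of these elements in $\mathfrak{e}_6$ is given by $$[(A,u,v,w),(t,s,x,y,z)]=(\tilde t,\tilde s,\tilde x,\tilde y,\tilde z),$$ where \begin{align*} \tilde t &= 2\langle u,x\rangle-2\langle w,z\rangle,\\ \tilde s &= 2\langle u,x\rangle-2\langle v,y\rangle,\\ \tilde x &= Ax+(t+s)u+\overline{vz}-\overline{yw},\\ \tilde y &= \lambda(A)y-(t-2s)v+\overline{wx}-\overline{zu},\\ \tilde z &= \lambda^2(A)z-(s-2t)w+\overline{uy}-\overline{xv}. \end{align*}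
   Context: Octonions: $\mathbb{O}$ is the 8-dimensional real octonion algebra with basis $e=e_0$ (the identity), $e_1,\dots,e_7$, where $e_i^2=-e$ for $i\ge1$ and $e_1e_2=e_3$, $e_1e_4=e_5$, $e_2e_4=e_6$, $e_3e_4=e_7$, $e_5e_3=e_6$, $e_6e_1=e_7$, $e_7e_2=e_5$ (the remaining products are determined by the alternative laws). Via this basis $\mathbb{O}=\mathbb{R}^8$ (column vectors), with standard scalar product $\langle\cdot,\cdot\rangle$. Conjugation $a\mapsto\bar a$ is linear with $\bar e_0=e_0$, $\bar e_i=-e_i$ for $i\ge1$. $\mathrm{Pu}(\mathbb{O})$ is the span of $e_1,\dots,e_7$. $L_a(x)=ax$, $R_a(x)=xa$. Wedge and triality: $\mathfrak{so}(8)$ is the Lie algebra of real skew-symmetric $8\times8$ matrices with commutator bracket; for $x,y\in\mathbb{O}=\mathbb{R}^8$, $x\wedge y:=xy^t-yx^t\in\mathfrak{so}(8)$ (matrix products). $\lambda$ is the order-three automorphism of $\mathfrak{so}(8)$ determined by $\lambda(a\wedge b)=\tfrac12 L_{\bar b}\circ L_{\bar a}$ for $a\in\mathrm{Pu}(\mathbb{O})$, $b\in\mathbb{O}$, $\langle a,b\rangle=0$; $\lambda^2=\lambda\circ\lambda$. $\Lambda$ is the automorphism of $\mathfrak{so}(8)\oplus\mathfrak{so}(8)$ given by $\Lambda(P,Q)=(\lambda(P),\lambda(Q))$, and $\Lambda^2=\Lambda\circ\Lambda$. Oct-octonions: $\mathbb{O}\otimes\mathbb{O}$ (tensor product over $\mathbb{R}$)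 has multiplication $(a\otimes b)\ast(c\otimes d)=ac\otimes bd$ and linear conjugation $\overline{a\otimes b}=\bar a\otimes\bar b$. It is identified with the space $\mathbb{R}(8)$ of real $8\times8$ matrices via $x\otimes y=xy^t$. For $A=(P,Q)\in\mathfrak{so}(8)\oplus\mathfrak{so}(8)$ and $X,Y\in\mathbb{R}(8)$: $A.X:=PX-XQ$ and $X\curlywedge Y:=(XY^t-YX^t,\;X^tY-Y^tX)$ (ordinary matrix products). The Lie algebra $\mathfrak{e}_8$ (compact real form) is the vector space $(\mathfrak{so}(8)\oplus\mathfrak{so}(8))\times(\mathbb{O}\otimes\mathbb{O})^3$ with Lie bracket $[(A,u,v,w),(B,x,y,z)]=(C,r,s,t)$, where \begin{align*} C &=[A,B]-4\,u \curlywedge x - 4\Lambda^2(v \curlywedge y) - 4\Lambda(w \curlywedge z),\\ r &= A.x-B.u+\overline{v \ast z}-\overline{y \ast w},\\ s &= \Lambda(A).y-\Lambda(B).v+\overline{w \ast x}-\overline{z \ast u},\\ t &= \Lambda^2(A).z-\Lambda^2(B).w+\overline{u \ast y}-\overline{x \ast v}. \end{align*} $\mathfrak{t}^2\subset\mathfrak{so}(8)$ is the abelian subalgebra spanned by $L_{e_1}$ and $R_{e_1}$, $\mathbb{C}\subset\mathbb{O}$ is the linear span of $e_0$ and $e_1$, and $\mathfrak{e}_6:=(\mathfrak{so}(8)\times\mathfrak{t}^2)\times(\mathbb{O}\otimes\mathbb{C})^3$ is a Lie subalgebra of $\mathfrak{e}_8$ ($\mathfrak{t}^2$ sits in the second $\mathfrak{so}(8)$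 summand). $\mathfrak{f}_4=\mathfrak{so}(8)\times\mathbb{O}^3$ is viewed as the subalgebra of $\mathfrak{e}_6$ via $(A,u,v,w)\mapsto((A,0),u\otimes e_0,v\otimes e_0,w\otimes e_0)$. In $V$, the element $tL_{e_1}+sR_{e_1}\in\mathfrak{t}^2$ stands for $(0,tL_{e_1}+sR_{e_1})\in\mathfrak{so}(8)\oplus\mathfrak{so}(8)$. Orthogonality is with respect to the scalar product on $\mathfrak{e}_8$ given by $\langle((A,B),u,v,w),((C,D),x,y,z)\rangle=8\,\mathrm{tr}(ux^t+vy^t+wz^t)-\mathrm{tr}(AC)-\mathrm{tr}(BD)$.
   Formalization: Seven signs are corrected, the printed ones being false: x̃ = Ax−(t+s)u−conj(vz)+conj(yw); ỹ has −conj(wx)+conj(zu); z̃ has −conj(uy)+conj(xv). E.g. v=z=e0, all else 0, gives x̃ = −e0, since conj(e1) = −e1. *)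

theory Defs
  imports "HOL-Analysis.Analysis"
begin

section \<open>Indices of \<open>\<real>\<^sup>8\<close>\<close>

text \<open>The coordinates are indexed by the library type \<^typ>\<open>8\<close> of integers modulo 8, whose
  elements are \<open>0, \<dots>, 7\<close>, so that the basis is \<open>e\<^sub>0, \<dots>, e\<^sub>7\<close>.\<close>

lemma exhaust_8: "x = 0 \<or> x = 1 \<or> x = 2 \<or> x = 3 \<or> x = 4 \<or> x = 5 \<or> x = 6 \<or> x = 7" for x :: 8
proof (induct x)
  case (of_int z)
  then have "z = 0 \<or> z = 1 \<or> z = 2 \<or> z = 3 \<or> z = 4 \<or> z = 5 \<or> z = 6 \<or> z = 7" by simp arith
  then show ?case by auto
qed

lemma forall_8: "(\<forall>i::8. P i) \<longleftrightarrow> P 0 \<and> P 1 \<and> P 2 \<and> P 3 \<and> P 4 \<and> P 5 \<and> P 6 \<and> P 7"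
  by (metis exhaust_8)

lemma UNIV_8: "(UNIV :: 8 set) = {0,1,2,3,4,5,6,7}"
  using exhaust_8 by blast

lemma sum_8: "sum f (UNIV :: 8 set) = f 0 + f 1 + f 2 + f 3 + f 4 + f 5 + f 6 + f 7"
  unfolding UNIV_8 by (simp add: ac_simps)


section \<open>Octonions\<close>

type_synonym oct = "real ^ 8"
type_synonym mat8 = "real ^ 8 ^ 8"

definition oct_e :: "8 \<Rightarrow> oct" where
  "oct_e i = axis i 1"

text \<open>The triples \<open>(i,j,k)\<close> with \<open>e\<^sub>i e\<^sub>j = e\<^sub>k\<close> that are prescribed. The alternative laws make the
  imaginary units anticommute and make \<open>e\<^sub>i e\<^sub>j = e\<^sub>k\<close> invariant under cyclic permutations;
  this gives all remaining products.\<close>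

definition oct_lines :: "(8 \<times> 8 \<times> 8) set" where
  "oct_lines = {(1,2,3), (1,4,5), (2,4,6), (3,4,7), (5,3,6), (6,1,7), (7,2,5)}"

definition oct_cyc :: "8 \<Rightarrow> 8 \<Rightarrow> 8 \<Rightarrow> bool" where
  "oct_cyc i j k \<longleftrightarrow> (i,j,k) \<in> oct_lines \<or> (j,k,i) \<in> oct_lines \<or> (k,i,j) \<in> oct_lines"

text \<open>The coefficient of \<open>e\<^sub>k\<close> in \<open>e\<^sub>i e\<^sub>j\<close>.\<close>

definition oct_coeff :: "8 \<Rightarrow> 8 \<Rightarrow> 8 \<Rightarrow> real" where
  "oct_coeff i j k =
    (if i = 0 then of_bool (k = j)
     else if j = 0 then of_bool (k = i)
     else if i = j then - of_bool (k = 0)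
     else of_bool (oct_cyc i j k) - of_bool (oct_cyc j i k))"

definition oct_mult :: "oct \<Rightarrow> oct \<Rightarrow> oct" (infixl "\<odot>" 70) where
  "x \<odot> y = (\<chi> k. \<Sum>i\<in>UNIV. \<Sum>j\<in>UNIV. oct_coeff i j k * (x$i * y$j))"

definition oct_cnj :: "oct \<Rightarrow> oct" where
  "oct_cnj x = (\<chi> i. if i = 0 then x$i else - x$i)"

definition oct_Pu :: "oct set" where
  "oct_Pu = span {oct_e 1, oct_e 2, oct_e 3, oct_e 4, oct_e 5, oct_e 6, oct_e 7}"

definition oct_L :: "oct \<Rightarrow> mat8" where
  "oct_L a = matrix (\<lambda>x. a \<odot> x)"

definition oct_R :: "oct \<Rightarrow> mat8" where
  "oct_R a = matrix (\<lambda>x. x \<odot> a)"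

lemma oct_cyc_table:
  "oct_cyc 1 2 k \<longleftrightarrow> k = 3"
  "oct_cyc 1 3 k \<longleftrightarrow> False"
  "oct_cyc 1 4 k \<longleftrightarrow> k = 5"
  "oct_cyc 1 5 k \<longleftrightarrow> False"
  "oct_cyc 1 6 k \<longleftrightarrow> False"
  "oct_cyc 1 7 k \<longleftrightarrow> k = 6"
  "oct_cyc 2 1 k \<longleftrightarrow> False"
  "oct_cyc 2 3 k \<longleftrightarrow> k = 1"
  "oct_cyc 2 4 k \<longleftrightarrow> k = 6"
  "oct_cyc 2 5 k \<longleftrightarrow> k = 7"
  "oct_cyc 2 6 k \<longleftrightarrow> False"
  "oct_cyc 2 7 k \<longleftrightarrow> False"
  "oct_cyc 3 1 k \<longleftrightarrow> k = 2"
  "oct_cyc 3 2 k \<longleftrightarrow> False"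
  "oct_cyc 3 4 k \<longleftrightarrow> k = 7"
  "oct_cyc 3 5 k \<longleftrightarrow> False"
  "oct_cyc 3 6 k \<longleftrightarrow> k = 5"
  "oct_cyc 3 7 k \<longleftrightarrow> False"
  "oct_cyc 4 1 k \<longleftrightarrow> False"
  "oct_cyc 4 2 k \<longleftrightarrow> False"
  "oct_cyc 4 3 k \<longleftrightarrow> False"
  "oct_cyc 4 5 k \<longleftrightarrow> k = 1"
  "oct_cyc 4 6 k \<longleftrightarrow> k = 2"
  "oct_cyc 4 7 k \<longleftrightarrow> k = 3"
  "oct_cyc 5 1 k \<longleftrightarrow> k = 4"
  "oct_cyc 5 2 k \<longleftrightarrow> False"
  "oct_cyc 5 3 k \<longleftrightarrow> k = 6"
  "oct_cyc 5 4 k \<longleftrightarrow> False"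
  "oct_cyc 5 6 k \<longleftrightarrow> False"
  "oct_cyc 5 7 k \<longleftrightarrow> k = 2"
  "oct_cyc 6 1 k \<longleftrightarrow> k = 7"
  "oct_cyc 6 2 k \<longleftrightarrow> k = 4"
  "oct_cyc 6 3 k \<longleftrightarrow> False"
  "oct_cyc 6 4 k \<longleftrightarrow> False"
  "oct_cyc 6 5 k \<longleftrightarrow> k = 3"
  "oct_cyc 6 7 k \<longleftrightarrow> False"
  "oct_cyc 7 1 k \<longleftrightarrow> False"
  "oct_cyc 7 2 k \<longleftrightarrow> k = 5"
  "oct_cyc 7 3 k \<longleftrightarrow> k = 4"
  "oct_cyc 7 4 k \<longleftrightarrow> False"
  "oct_cyc 7 5 k \<longleftrightarrow> False"
  "oct_cyc 7 6 k \<longleftrightarrow> k = 1"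
  by (simp_all add: oct_cyc_def oct_lines_def)

lemma oct_coeff_table:
  "oct_coeff 0 0 k = of_bool (k = 0)"
  "oct_coeff 0 1 k = of_bool (k = 1)"
  "oct_coeff 0 2 k = of_bool (k = 2)"
  "oct_coeff 0 3 k = of_bool (k = 3)"
  "oct_coeff 0 4 k = of_bool (k = 4)"
  "oct_coeff 0 5 k = of_bool (k = 5)"
  "oct_coeff 0 6 k = of_bool (k = 6)"
  "oct_coeff 0 7 k = of_bool (k = 7)"
  "oct_coeff 1 0 k = of_bool (k = 1)"
  "oct_coeff 1 1 k = - of_bool (k = 0)"
  "oct_coeff 1 2 k = of_bool (k = 3)"
  "oct_coeff 1 3 k = - of_bool (k = 2)"
  "oct_coeff 1 4 k = of_bool (k = 5)"
  "oct_coeff 1 5 k = - of_bool (k = 4)"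
  "oct_coeff 1 6 k = - of_bool (k = 7)"
  "oct_coeff 1 7 k = of_bool (k = 6)"
  "oct_coeff 2 0 k = of_bool (k = 2)"
  "oct_coeff 2 1 k = - of_bool (k = 3)"
  "oct_coeff 2 2 k = - of_bool (k = 0)"
  "oct_coeff 2 3 k = of_bool (k = 1)"
  "oct_coeff 2 4 k = of_bool (k = 6)"
  "oct_coeff 2 5 k = of_bool (k = 7)"
  "oct_coeff 2 6 k = - of_bool (k = 4)"
  "oct_coeff 2 7 k = - of_bool (k = 5)"
  "oct_coeff 3 0 k = of_bool (k = 3)"
  "oct_coeff 3 1 k = of_bool (k = 2)"
  "oct_coeff 3 2 k = - of_bool (k = 1)"
  "oct_coeff 3 3 k = - of_bool (k = 0)"
  "oct_coeff 3 4 k = of_bool (k = 7)"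
  "oct_coeff 3 5 k = - of_bool (k = 6)"
  "oct_coeff 3 6 k = of_bool (k = 5)"
  "oct_coeff 3 7 k = - of_bool (k = 4)"
  "oct_coeff 4 0 k = of_bool (k = 4)"
  "oct_coeff 4 1 k = - of_bool (k = 5)"
  "oct_coeff 4 2 k = - of_bool (k = 6)"
  "oct_coeff 4 3 k = - of_bool (k = 7)"
  "oct_coeff 4 4 k = - of_bool (k = 0)"
  "oct_coeff 4 5 k = of_bool (k = 1)"
  "oct_coeff 4 6 k = of_bool (k = 2)"
  "oct_coeff 4 7 k = of_bool (k = 3)"
  "oct_coeff 5 0 k = of_bool (k = 5)"
  "oct_coeff 5 1 k = of_bool (k = 4)"
  "oct_coeff 5 2 k = - of_bool (k = 7)"
  "oct_coeff 5 3 k = of_bool (k = 6)"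
  "oct_coeff 5 4 k = - of_bool (k = 1)"
  "oct_coeff 5 5 k = - of_bool (k = 0)"
  "oct_coeff 5 6 k = - of_bool (k = 3)"
  "oct_coeff 5 7 k = of_bool (k = 2)"
  "oct_coeff 6 0 k = of_bool (k = 6)"
  "oct_coeff 6 1 k = of_bool (k = 7)"
  "oct_coeff 6 2 k = of_bool (k = 4)"
  "oct_coeff 6 3 k = - of_bool (k = 5)"
  "oct_coeff 6 4 k = - of_bool (k = 2)"
  "oct_coeff 6 5 k = of_bool (k = 3)"
  "oct_coeff 6 6 k = - of_bool (k = 0)"
  "oct_coeff 6 7 k = - of_bool (k = 1)"
  "oct_coeff 7 0 k = of_bool (k = 7)"
  "oct_coeff 7 1 k = - of_bool (k = 6)"
  "oct_coeff 7 2 k = of_bool (k = 5)"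
  "oct_coeff 7 3 k = of_bool (k = 4)"
  "oct_coeff 7 4 k = - of_bool (k = 3)"
  "oct_coeff 7 5 k = - of_bool (k = 2)"
  "oct_coeff 7 6 k = of_bool (k = 1)"
  "oct_coeff 7 7 k = - of_bool (k = 0)"
  by (simp_all add: oct_coeff_def oct_cyc_table)

lemma oct_mult_nth:
  "(x \<odot> y)$0 = x$0 * y$0 - x$1 * y$1 - x$2 * y$2 - x$3 * y$3 - x$4 * y$4 - x$5 * y$5 - x$6 * y$6 - x$7 * y$7"
  "(x \<odot> y)$1 = x$0 * y$1 + x$1 * y$0 + x$2 * y$3 - x$3 * y$2 + x$4 * y$5 - x$5 * y$4 - x$6 * y$7 + x$7 * y$6"
  "(x \<odot> y)$2 = x$0 * y$2 - x$1 * y$3 + x$2 * y$0 + x$3 * y$1 + x$4 * y$6 + x$5 * y$7 - x$6 * y$4 - x$7 * y$5"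
  "(x \<odot> y)$3 = x$0 * y$3 + x$1 * y$2 - x$2 * y$1 + x$3 * y$0 + x$4 * y$7 - x$5 * y$6 + x$6 * y$5 - x$7 * y$4"
  "(x \<odot> y)$4 = x$0 * y$4 - x$1 * y$5 - x$2 * y$6 - x$3 * y$7 + x$4 * y$0 + x$5 * y$1 + x$6 * y$2 + x$7 * y$3"
  "(x \<odot> y)$5 = x$0 * y$5 + x$1 * y$4 - x$2 * y$7 + x$3 * y$6 - x$4 * y$1 + x$5 * y$0 - x$6 * y$3 + x$7 * y$2"
  "(x \<odot> y)$6 = x$0 * y$6 + x$1 * y$7 + x$2 * y$4 - x$3 * y$5 - x$4 * y$2 + x$5 * y$3 + x$6 * y$0 - x$7 * y$1"
  "(x \<odot> y)$7 = x$0 * y$7 - x$1 * y$6 + x$2 * y$5 + x$3 * y$4 - x$4 * y$3 - x$5 * y$2 + x$6 * y$1 + x$7 * y$0"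
  by (simp_all add: oct_mult_def sum_8 oct_coeff_table)

lemma oct_e_nth: "oct_e i $ j = of_bool (i = j)"
  by (auto simp: oct_e_def axis_def)

lemma oct_products:
  "oct_e 0 \<odot> x = x" "x \<odot> oct_e 0 = x"
  "i \<noteq> 0 \<Longrightarrow> oct_e i \<odot> oct_e i = - oct_e 0"
  "oct_e 1 \<odot> oct_e 2 = oct_e 3" "oct_e 1 \<odot> oct_e 4 = oct_e 5" "oct_e 2 \<odot> oct_e 4 = oct_e 6" "oct_e 3 \<odot> oct_e 4 = oct_e 7"
  "oct_e 5 \<odot> oct_e 3 = oct_e 6" "oct_e 6 \<odot> oct_e 1 = oct_e 7" "oct_e 7 \<odot> oct_e 2 = oct_e 5"
  using exhaust_8[of i] by (auto simp: vec_eq_iff forall_8 oct_mult_nth oct_e_nth)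

lemma oct_alternative:
  "(x \<odot> x) \<odot> y = x \<odot> (x \<odot> y)"
  "(y \<odot> x) \<odot> x = y \<odot> (x \<odot> x)"
  by (simp_all add: vec_eq_iff forall_8 oct_mult_nth algebra_simps)


section \<open>The triality automorphism of \<open>so(8)\<close>\<close>

definition so8 :: "mat8 set" where
  "so8 = {A. transpose A = - A}"

definition mat_bracket :: "mat8 \<Rightarrow> mat8 \<Rightarrow> mat8" where
  "mat_bracket A B = A ** B - B ** A"

text \<open>\<open>outer x y\<close> is the matrix \<open>x y\<^sup>t\<close>.\<close>

definition outer :: "oct \<Rightarrow> oct \<Rightarrow> mat8" where
  "outer x y = (\<chi> i j. x$i * y$j)"

definition wedge :: "oct \<Rightarrow> oct \<Rightarrow> mat8" where
  "wedge x y = outer x y - outer y x"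

definition so8_automorphism :: "(mat8 \<Rightarrow> mat8) \<Rightarrow> bool" where
  "so8_automorphism f \<longleftrightarrow>
     bij_betw f so8 so8 \<and>
     (\<forall>A\<in>so8. \<forall>B\<in>so8. f (A + B) = f A + f B) \<and>
     (\<forall>c. \<forall>A\<in>so8. f (c *\<^sub>R A) = c *\<^sub>R f A) \<and>
     (\<forall>A\<in>so8. \<forall>B\<in>so8. f (mat_bracket A B) = mat_bracket (f A) (f B))"

definition is_triality :: "(mat8 \<Rightarrow> mat8) \<Rightarrow> bool" where
  "is_triality f \<longleftrightarrow>
     so8_automorphism f \<and>
     (\<exists>A\<in>so8. f A \<noteq> A) \<and> (\<forall>A\<in>so8. f (f (f A)) = A) \<and>
     (\<forall>a\<in>oct_Pu. \<forall>b. a \<bullet> b = 0 \<longrightarrow>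
        f (wedge a b) = (1/2) *\<^sub>R (oct_L (oct_cnj b) ** oct_L (oct_cnj a)))"

text \<open>Maps on \<open>so(8)\<close> are total functions that are \<^const>\<open>undefined\<close> elsewhere;
  \<open>triality_ex1\<close> below shows that the description is proper.\<close>

definition triality :: "mat8 \<Rightarrow> mat8" where
  "triality = (THE f. f \<in> extensional so8 \<and> is_triality f)"


section \<open>\<open>\<O> \<otimes> \<O>\<close> as \<open>8 \<times> 8\<close> matrices, and \<open>e\<^sub>8\<close>\<close>

text \<open>\<open>x \<otimes> y\<close> is \<^term>\<open>outer x y\<close>, so the matrix \<^term>\<open>X\<close> is
  the sum of the \<open>X$i$j (e\<^sub>i \<otimes> e\<^sub>j)\<close>; multiplication and conjugation are extended (bi)linearly.\<close>

definition oo_mult :: "mat8 \<Rightarrow> mat8 \<Rightarrow> mat8" (infixl "\<star>" 70) where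
  "X \<star> Y = (\<Sum>i\<in>UNIV. \<Sum>j\<in>UNIV. \<Sum>k\<in>UNIV. \<Sum>l\<in>UNIV.
     (X$i$j * Y$k$l) *\<^sub>R outer (oct_e i \<odot> oct_e k) (oct_e j \<odot> oct_e l))"

definition oo_cnj :: "mat8 \<Rightarrow> mat8" where
  "oo_cnj X = (\<Sum>i\<in>UNIV. \<Sum>j\<in>UNIV. X$i$j *\<^sub>R outer (oct_cnj (oct_e i)) (oct_cnj (oct_e j)))"

fun pair_bracket :: "mat8 \<times> mat8 \<Rightarrow> mat8 \<times> mat8 \<Rightarrow> mat8 \<times> mat8" where
  "pair_bracket (P, Q) (P', Q') = (mat_bracket P P', mat_bracket Q Q')"

text \<open>The map \<open>\<Lambda>\<close>.\<close>

definition Triality :: "mat8 \<times> mat8 \<Rightarrow> mat8 \<times> mat8" where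
  "Triality = map_prod triality triality"

text \<open>The operation \<open>A.X\<close>.\<close>

fun pair_act :: "mat8 \<times> mat8 \<Rightarrow> mat8 \<Rightarrow> mat8" where
  "pair_act (P, Q) X = P ** X - X ** Q"

definition curly_wedge :: "mat8 \<Rightarrow> mat8 \<Rightarrow> mat8 \<times> mat8" where
  "curly_wedge X Y =
     (X ** transpose Y - Y ** transpose X, transpose X ** Y - transpose Y ** X)"

type_synonym e8_vec = "(mat8 \<times> mat8) \<times> mat8 \<times> mat8 \<times> mat8"

definition e8 :: "e8_vec set" where
  "e8 = (so8 \<times> so8) \<times> UNIV \<times> UNIV \<times> UNIV"

fun e8_bracket :: "e8_vec \<Rightarrow> e8_vec \<Rightarrow> e8_vec" where
  "e8_bracket (A, u, v, w) (B, x, y, z) =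
    (pair_bracket A B - 4 *\<^sub>R curly_wedge u x
       - 4 *\<^sub>R Triality (Triality (curly_wedge v y)) - 4 *\<^sub>R Triality (curly_wedge w z),
     pair_act A x - pair_act B u + oo_cnj (v \<star> z) - oo_cnj (y \<star> w),
     pair_act (Triality A) y - pair_act (Triality B) v + oo_cnj (w \<star> x) - oo_cnj (z \<star> u),
     pair_act (Triality (Triality A)) z - pair_act (Triality (Triality B)) w
       + oo_cnj (u \<star> y) - oo_cnj (x \<star> v))"

fun e8_inner :: "e8_vec \<Rightarrow> e8_vec \<Rightarrow> real" where
  "e8_inner ((A, B), u, v, w) ((C, D), x, y, z) =
    8 * trace (u ** transpose x + v ** transpose y + w ** transpose z)
      - trace (A ** C) - trace (B ** D)"


section \<open>\<open>f\<^sub>4\<close> inside \<open>e\<^sub>6\<close>\<close>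

definition t2 :: "mat8 set" where
  "t2 = span {oct_L (oct_e 1), oct_R (oct_e 1)}"

text \<open>The subspace of the octonions that is a copy of the complex numbers.\<close>

definition oct_C :: "oct set" where
  "oct_C = span {oct_e 0, oct_e 1}"

text \<open>\<open>\<O> \<otimes> \<C>\<close>, as a subspace of the \<open>8 \<times> 8\<close> matrices.\<close>

definition OC :: "mat8 set" where
  "OC = span {outer x c | x c. c \<in> oct_C}"

definition e6 :: "e8_vec set" where
  "e6 = (so8 \<times> t2) \<times> OC \<times> OC \<times> OC"

fun f4_embed :: "mat8 \<times> oct \<times> oct \<times> oct \<Rightarrow> e8_vec" where
  "f4_embed (A, u, v, w) = ((A, 0), outer u (oct_e 0), outer v (oct_e 0), outer w (oct_e 0))"

definition f4 :: "e8_vec set" where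
  "f4 = f4_embed ` (so8 \<times> UNIV \<times> UNIV \<times> UNIV)"

definition f4_perp :: "e8_vec set" where
  "f4_perp = {X \<in> e6. \<forall>Y \<in> f4. e8_inner X Y = 0}"

fun f4_perp_iso :: "real \<times> real \<times> oct \<times> oct \<times> oct \<Rightarrow> e8_vec" where
  "f4_perp_iso (t, s, u, v, w) =
    ((0, t *\<^sub>R oct_L (oct_e 1) + s *\<^sub>R oct_R (oct_e 1)), outer u (oct_e 1), outer v (oct_e 1), outer w (oct_e 1))"


section \<open>Existence and uniqueness of the triality automorphism\<close>

lemma so8_iff: "A \<in> so8 \<longleftrightarrow> (\<forall>i j. A$j$i = - A$i$j)"
  by (auto simp: so8_def transpose_def vec_eq_iff)

lemma so8_nth:
  assumes "A \<in> so8"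
  shows
  "A$1$0 = - A$0$1"
  "A$2$0 = - A$0$2"
  "A$3$0 = - A$0$3"
  "A$4$0 = - A$0$4"
  "A$5$0 = - A$0$5"
  "A$6$0 = - A$0$6"
  "A$7$0 = - A$0$7"
  "A$2$1 = - A$1$2"
  "A$3$1 = - A$1$3"
  "A$4$1 = - A$1$4"
  "A$5$1 = - A$1$5"
  "A$6$1 = - A$1$6"
  "A$7$1 = - A$1$7"
  "A$3$2 = - A$2$3"
  "A$4$2 = - A$2$4"
  "A$5$2 = - A$2$5"
  "A$6$2 = - A$2$6"
  "A$7$2 = - A$2$7"
  "A$4$3 = - A$3$4"
  "A$5$3 = - A$3$5"
  "A$6$3 = - A$3$6"
  "A$7$3 = - A$3$7"
  "A$5$4 = - A$4$5"
  "A$6$4 = - A$4$6"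
  "A$7$4 = - A$4$7"
  "A$6$5 = - A$5$6"
  "A$7$5 = - A$5$7"
  "A$7$6 = - A$6$7"
  "A$0$0 = 0"
  "A$1$1 = 0"
  "A$2$2 = 0"
  "A$3$3 = 0"
  "A$4$4 = 0"
  "A$5$5 = 0"
  "A$6$6 = 0"
  "A$7$7 = 0"
proof -
  have neg: "A$j$i = - A$i$j" for i j using assms unfolding so8_iff by blast
  have diag: "A$i$i = 0" for i using neg[of i i] by simp
  show
    "A$1$0 = - A$0$1"
    "A$2$0 = - A$0$2"
    "A$3$0 = - A$0$3"
    "A$4$0 = - A$0$4"
    "A$5$0 = - A$0$5"
    "A$6$0 = - A$0$6"
    "A$7$0 = - A$0$7"
    "A$2$1 = - A$1$2"
    "A$3$1 = - A$1$3"
    "A$4$1 = - A$1$4"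
    "A$5$1 = - A$1$5"
    "A$6$1 = - A$1$6"
    "A$7$1 = - A$1$7"
    "A$3$2 = - A$2$3"
    "A$4$2 = - A$2$4"
    "A$5$2 = - A$2$5"
    "A$6$2 = - A$2$6"
    "A$7$2 = - A$2$7"
    "A$4$3 = - A$3$4"
    "A$5$3 = - A$3$5"
    "A$6$3 = - A$3$6"
    "A$7$3 = - A$3$7"
    "A$5$4 = - A$4$5"
    "A$6$4 = - A$4$6"
    "A$7$4 = - A$4$7"
    "A$6$5 = - A$5$6"
    "A$7$5 = - A$5$7"
    "A$7$6 = - A$6$7"
    "A$0$0 = 0"
    "A$1$1 = 0"
    "A$2$2 = 0"
    "A$3$3 = 0"
    "A$4$4 = 0"
    "A$5$5 = 0"
    "A$6$6 = 0"
    "A$7$7 = 0"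
    by (rule neg diag)+
qed

lemma so8_eqI:
  assumes "A \<in> so8" "B \<in> so8"
    "A$0$1 = B$0$1" "A$0$2 = B$0$2" "A$0$3 = B$0$3" "A$0$4 = B$0$4" "A$0$5 = B$0$5" "A$0$6 = B$0$6" "A$0$7 = B$0$7"
    "A$1$2 = B$1$2" "A$1$3 = B$1$3" "A$1$4 = B$1$4" "A$1$5 = B$1$5" "A$1$6 = B$1$6" "A$1$7 = B$1$7"
    "A$2$3 = B$2$3" "A$2$4 = B$2$4" "A$2$5 = B$2$5" "A$2$6 = B$2$6" "A$2$7 = B$2$7"
    "A$3$4 = B$3$4" "A$3$5 = B$3$5" "A$3$6 = B$3$6" "A$3$7 = B$3$7"
    "A$4$5 = B$4$5" "A$4$6 = B$4$6" "A$4$7 = B$4$7"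
    "A$5$6 = B$5$6" "A$5$7 = B$5$7"
    "A$6$7 = B$6$7"
  shows "A = B"
  using assms(3-) by (simp add: vec_eq_iff forall_8 so8_nth[OF assms(1)] so8_nth[OF assms(2)])

lemma transpose_add: "transpose (A + B) = transpose A + transpose B" for A B :: mat8
  by (simp add: transpose_def vec_eq_iff)

lemma transpose_diff: "transpose (A - B) = transpose A - transpose B" for A B :: mat8
  by (simp add: transpose_def vec_eq_iff)

lemma transpose_outer: "transpose (outer x y) = outer y x"
  by (simp add: transpose_def outer_def vec_eq_iff)

lemma neg_matrix_mult_neg: "(- A) ** (- B) = A ** B" for A B :: mat8
  by (simp add: vec_eq_iff matrix_matrix_mult_def)

lemma so8_closed:
  "0 \<in> so8"
  "A \<in> so8 \<Longrightarrow> B \<in> so8 \<Longrightarrow> A + B \<in> so8"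
  "A \<in> so8 \<Longrightarrow> c *\<^sub>R A \<in> so8"
  "wedge x y \<in> so8"
  by (simp_all add: so8_def transpose_add transpose_diff transpose_outer transpose_scalar wedge_def)
     (simp add: transpose_def vec_eq_iff)

lemma mat_bracket_so8:
  assumes "A \<in> so8" "B \<in> so8"
  shows "mat_bracket A B \<in> so8"
  using assms
  by (simp add: so8_def mat_bracket_def transpose_diff matrix_transpose_mul neg_matrix_mult_neg)

text \<open>Twice the triality automorphism and twice its square, in coordinates. Note that the list
  constructor \<open>vector\<close> starts at index 1 and so ends with the entry at index \<open>8 = 0\<close>.\<close>

definition trial2 :: "mat8 \<Rightarrow> mat8" where
  "trial2 A = (vector [
    vector [0,
      - A$0$3 + A$1$2 - A$4$7 + A$5$6,
      A$0$2 + A$1$3 + A$4$6 + A$5$7,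
      - A$0$5 + A$1$4 + A$2$7 - A$3$6,
      A$0$4 + A$1$5 - A$2$6 - A$3$7,
      A$0$7 + A$1$6 + A$2$5 + A$3$4,
      - A$0$6 + A$1$7 - A$2$4 + A$3$5,
      A$0$1 - A$2$3 - A$4$5 + A$6$7],
    vector [A$0$3 - A$1$2 + A$4$7 - A$5$6,
      0,
      - A$0$1 + A$2$3 - A$4$5 + A$6$7,
      - A$0$6 - A$1$7 + A$2$4 + A$3$5,
      - A$0$7 + A$1$6 + A$2$5 - A$3$4,
      A$0$4 - A$1$5 + A$2$6 - A$3$7,
      A$0$5 + A$1$4 + A$2$7 + A$3$6,
      A$0$2 + A$1$3 - A$4$6 - A$5$7],
    vector [- A$0$2 - A$1$3 - A$4$6 - A$5$7,
      A$0$1 - A$2$3 + A$4$5 - A$6$7,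
      0,
      - A$0$7 + A$1$6 - A$2$5 + A$3$4,
      A$0$6 + A$1$7 + A$2$4 + A$3$5,
      - A$0$5 - A$1$4 + A$2$7 + A$3$6,
      A$0$4 - A$1$5 - A$2$6 + A$3$7,
      A$0$3 - A$1$2 - A$4$7 + A$5$6],
    vector [A$0$5 - A$1$4 - A$2$7 + A$3$6,
      A$0$6 + A$1$7 - A$2$4 - A$3$5,
      A$0$7 - A$1$6 + A$2$5 - A$3$4,
      0,
      - A$0$1 - A$2$3 + A$4$5 + A$6$7,
      - A$0$2 + A$1$3 + A$4$6 - A$5$7,
      - A$0$3 - A$1$2 + A$4$7 + A$5$6,
      A$0$4 + A$1$5 + A$2$6 + A$3$7],
    vector [- A$0$4 - A$1$5 + A$2$6 + A$3$7,
      A$0$7 - A$1$6 - A$2$5 + A$3$4,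
      - A$0$6 - A$1$7 - A$2$4 - A$3$5,
      A$0$1 + A$2$3 - A$4$5 - A$6$7,
      0,
      A$0$3 + A$1$2 + A$4$7 + A$5$6,
      - A$0$2 + A$1$3 - A$4$6 + A$5$7,
      A$0$5 - A$1$4 + A$2$7 - A$3$6],
    vector [- A$0$7 - A$1$6 - A$2$5 - A$3$4,
      - A$0$4 + A$1$5 - A$2$6 + A$3$7,
      A$0$5 + A$1$4 - A$2$7 - A$3$6,
      A$0$2 - A$1$3 - A$4$6 + A$5$7,
      - A$0$3 - A$1$2 - A$4$7 - A$5$6,
      0,
      A$0$1 + A$2$3 + A$4$5 + A$6$7,
      A$0$6 - A$1$7 - A$2$4 + A$3$5],
    vector [A$0$6 - A$1$7 + A$2$4 - A$3$5,
      - A$0$5 - A$1$4 - A$2$7 - A$3$6,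
      - A$0$4 + A$1$5 + A$2$6 - A$3$7,
      A$0$3 + A$1$2 - A$4$7 - A$5$6,
      A$0$2 - A$1$3 + A$4$6 - A$5$7,
      - A$0$1 - A$2$3 - A$4$5 - A$6$7,
      0,
      A$0$7 + A$1$6 - A$2$5 - A$3$4],
    vector [- A$0$1 + A$2$3 + A$4$5 - A$6$7,
      - A$0$2 - A$1$3 + A$4$6 + A$5$7,
      - A$0$3 + A$1$2 + A$4$7 - A$5$6,
      - A$0$4 - A$1$5 - A$2$6 - A$3$7,
      - A$0$5 + A$1$4 - A$2$7 + A$3$6,
      - A$0$6 + A$1$7 + A$2$4 - A$3$5,
      - A$0$7 - A$1$6 + A$2$5 + A$3$4,
      0]])"

lemma vector_8:
  "(vector [a0,a1,a2,a3,a4,a5,a6,a7] :: ('a::zero)^8)$1 = a0"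
  "(vector [a0,a1,a2,a3,a4,a5,a6,a7] :: ('a::zero)^8)$2 = a1"
  "(vector [a0,a1,a2,a3,a4,a5,a6,a7] :: ('a::zero)^8)$3 = a2"
  "(vector [a0,a1,a2,a3,a4,a5,a6,a7] :: ('a::zero)^8)$4 = a3"
  "(vector [a0,a1,a2,a3,a4,a5,a6,a7] :: ('a::zero)^8)$5 = a4"
  "(vector [a0,a1,a2,a3,a4,a5,a6,a7] :: ('a::zero)^8)$6 = a5"
  "(vector [a0,a1,a2,a3,a4,a5,a6,a7] :: ('a::zero)^8)$7 = a6"
  "(vector [a0,a1,a2,a3,a4,a5,a6,a7] :: ('a::zero)^8)$0 = a7"
  unfolding vector_def by simp_all

lemma trial2_nth:
  "trial2 A $0$0 = 0"
  "trial2 A $0$1 = - A$0$1 + A$2$3 + A$4$5 - A$6$7"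
  "trial2 A $0$2 = - A$0$2 - A$1$3 + A$4$6 + A$5$7"
  "trial2 A $0$3 = - A$0$3 + A$1$2 + A$4$7 - A$5$6"
  "trial2 A $0$4 = - A$0$4 - A$1$5 - A$2$6 - A$3$7"
  "trial2 A $0$5 = - A$0$5 + A$1$4 - A$2$7 + A$3$6"
  "trial2 A $0$6 = - A$0$6 + A$1$7 + A$2$4 - A$3$5"
  "trial2 A $0$7 = - A$0$7 - A$1$6 + A$2$5 + A$3$4"
  "trial2 A $1$0 = A$0$1 - A$2$3 - A$4$5 + A$6$7"
  "trial2 A $1$1 = 0"
  "trial2 A $1$2 = - A$0$3 + A$1$2 - A$4$7 + A$5$6"
  "trial2 A $1$3 = A$0$2 + A$1$3 + A$4$6 + A$5$7"
  "trial2 A $1$4 = - A$0$5 + A$1$4 + A$2$7 - A$3$6"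
  "trial2 A $1$5 = A$0$4 + A$1$5 - A$2$6 - A$3$7"
  "trial2 A $1$6 = A$0$7 + A$1$6 + A$2$5 + A$3$4"
  "trial2 A $1$7 = - A$0$6 + A$1$7 - A$2$4 + A$3$5"
  "trial2 A $2$0 = A$0$2 + A$1$3 - A$4$6 - A$5$7"
  "trial2 A $2$1 = A$0$3 - A$1$2 + A$4$7 - A$5$6"
  "trial2 A $2$2 = 0"
  "trial2 A $2$3 = - A$0$1 + A$2$3 - A$4$5 + A$6$7"
  "trial2 A $2$4 = - A$0$6 - A$1$7 + A$2$4 + A$3$5"
  "trial2 A $2$5 = - A$0$7 + A$1$6 + A$2$5 - A$3$4"
  "trial2 A $2$6 = A$0$4 - A$1$5 + A$2$6 - A$3$7"
  "trial2 A $2$7 = A$0$5 + A$1$4 + A$2$7 + A$3$6"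
  "trial2 A $3$0 = A$0$3 - A$1$2 - A$4$7 + A$5$6"
  "trial2 A $3$1 = - A$0$2 - A$1$3 - A$4$6 - A$5$7"
  "trial2 A $3$2 = A$0$1 - A$2$3 + A$4$5 - A$6$7"
  "trial2 A $3$3 = 0"
  "trial2 A $3$4 = - A$0$7 + A$1$6 - A$2$5 + A$3$4"
  "trial2 A $3$5 = A$0$6 + A$1$7 + A$2$4 + A$3$5"
  "trial2 A $3$6 = - A$0$5 - A$1$4 + A$2$7 + A$3$6"
  "trial2 A $3$7 = A$0$4 - A$1$5 - A$2$6 + A$3$7"
  "trial2 A $4$0 = A$0$4 + A$1$5 + A$2$6 + A$3$7"
  "trial2 A $4$1 = A$0$5 - A$1$4 - A$2$7 + A$3$6"
  "trial2 A $4$2 = A$0$6 + A$1$7 - A$2$4 - A$3$5"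
  "trial2 A $4$3 = A$0$7 - A$1$6 + A$2$5 - A$3$4"
  "trial2 A $4$4 = 0"
  "trial2 A $4$5 = - A$0$1 - A$2$3 + A$4$5 + A$6$7"
  "trial2 A $4$6 = - A$0$2 + A$1$3 + A$4$6 - A$5$7"
  "trial2 A $4$7 = - A$0$3 - A$1$2 + A$4$7 + A$5$6"
  "trial2 A $5$0 = A$0$5 - A$1$4 + A$2$7 - A$3$6"
  "trial2 A $5$1 = - A$0$4 - A$1$5 + A$2$6 + A$3$7"
  "trial2 A $5$2 = A$0$7 - A$1$6 - A$2$5 + A$3$4"
  "trial2 A $5$3 = - A$0$6 - A$1$7 - A$2$4 - A$3$5"
  "trial2 A $5$4 = A$0$1 + A$2$3 - A$4$5 - A$6$7"
  "trial2 A $5$5 = 0"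
  "trial2 A $5$6 = A$0$3 + A$1$2 + A$4$7 + A$5$6"
  "trial2 A $5$7 = - A$0$2 + A$1$3 - A$4$6 + A$5$7"
  "trial2 A $6$0 = A$0$6 - A$1$7 - A$2$4 + A$3$5"
  "trial2 A $6$1 = - A$0$7 - A$1$6 - A$2$5 - A$3$4"
  "trial2 A $6$2 = - A$0$4 + A$1$5 - A$2$6 + A$3$7"
  "trial2 A $6$3 = A$0$5 + A$1$4 - A$2$7 - A$3$6"
  "trial2 A $6$4 = A$0$2 - A$1$3 - A$4$6 + A$5$7"
  "trial2 A $6$5 = - A$0$3 - A$1$2 - A$4$7 - A$5$6"
  "trial2 A $6$6 = 0"
  "trial2 A $6$7 = A$0$1 + A$2$3 + A$4$5 + A$6$7"
  "trial2 A $7$0 = A$0$7 + A$1$6 - A$2$5 - A$3$4"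
  "trial2 A $7$1 = A$0$6 - A$1$7 + A$2$4 - A$3$5"
  "trial2 A $7$2 = - A$0$5 - A$1$4 - A$2$7 - A$3$6"
  "trial2 A $7$3 = - A$0$4 + A$1$5 + A$2$6 - A$3$7"
  "trial2 A $7$4 = A$0$3 + A$1$2 - A$4$7 - A$5$6"
  "trial2 A $7$5 = A$0$2 - A$1$3 + A$4$6 - A$5$7"
  "trial2 A $7$6 = - A$0$1 - A$2$3 - A$4$5 - A$6$7"
  "trial2 A $7$7 = 0"
  by (simp_all only: trial2_def vector_8)

lemma trial2_so8: "trial2 A \<in> so8"
  by (simp add: so8_def transpose_def vec_eq_iff forall_8 trial2_nth)

lemma wedge_nth: "wedge x y $ i $ j = x$i * y$j - y$i * x$j"
  by (simp add: wedge_def outer_def)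

lemma wedge_flip: "wedge x y = (- 1) *\<^sub>R wedge y x"
  by (simp add: wedge_def)

lemma sum_pick: "(\<Sum>j\<in>UNIV. f j * of_bool (j = q)) = f q" for f :: "8 \<Rightarrow> real"
  by (subst sum.mono_neutral_right[of _ "{q}"]) auto

lemma so8_expand:
  assumes "A \<in> so8"
  shows "A = (\<Sum>i\<in>UNIV. \<Sum>j\<in>UNIV. (A$i$j / 2) *\<^sub>R wedge (oct_e i) (oct_e j))"
proof -
  have neg: "A$q$p = - A$p$q" for p q using assms unfolding so8_iff by blast
  have "(\<Sum>i\<in>UNIV. \<Sum>j\<in>UNIV. A$i$j / 2 * wedge (oct_e i) (oct_e j) $ p $ q) = A$p$q" for p q
  proof -
    have "(\<Sum>i\<in>UNIV. \<Sum>j\<in>UNIV. A$i$j / 2 * wedge (oct_e i) (oct_e j) $ p $ q) =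
        (\<Sum>i\<in>UNIV. \<Sum>j\<in>UNIV. A$i$j / 2 * (of_bool (i = p) * of_bool (j = q))) -
        (\<Sum>i\<in>UNIV. \<Sum>j\<in>UNIV. A$i$j / 2 * (of_bool (j = p) * of_bool (i = q)))"
      by (simp add: wedge_nth oct_e_nth sum_subtractf right_diff_distrib)
    also have "\<dots> = A$p$q / 2 - A$q$p / 2"
      by (simp only: mult.assoc[symmetric] sum_distrib_right[symmetric] sum_pick)
    finally show ?thesis using neg[of q p] by linarith
  qed
  then show ?thesis by (simp add: vec_eq_iff)
qed

lemma so8_induct:
  assumes "A \<in> so8"
    and zero: "P 0"
    and add: "\<And>A B. A \<in> so8 \<Longrightarrow> B \<in> so8 \<Longrightarrow> P A \<Longrightarrow> P B \<Longrightarrow> P (A + B)"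
    and scale: "\<And>c A. A \<in> so8 \<Longrightarrow> P A \<Longrightarrow> P (c *\<^sub>R A)"
    and base:
    "P (wedge (oct_e 0) (oct_e 1))" "P (wedge (oct_e 0) (oct_e 2))" "P (wedge (oct_e 0) (oct_e 3))" "P (wedge (oct_e 0) (oct_e 4))" "P (wedge (oct_e 0) (oct_e 5))" "P (wedge (oct_e 0) (oct_e 6))" "P (wedge (oct_e 0) (oct_e 7))"
    "P (wedge (oct_e 1) (oct_e 2))" "P (wedge (oct_e 1) (oct_e 3))" "P (wedge (oct_e 1) (oct_e 4))" "P (wedge (oct_e 1) (oct_e 5))" "P (wedge (oct_e 1) (oct_e 6))" "P (wedge (oct_e 1) (oct_e 7))"
    "P (wedge (oct_e 2) (oct_e 3))" "P (wedge (oct_e 2) (oct_e 4))" "P (wedge (oct_e 2) (oct_e 5))" "P (wedge (oct_e 2) (oct_e 6))" "P (wedge (oct_e 2) (oct_e 7))"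
    "P (wedge (oct_e 3) (oct_e 4))" "P (wedge (oct_e 3) (oct_e 5))" "P (wedge (oct_e 3) (oct_e 6))" "P (wedge (oct_e 3) (oct_e 7))"
    "P (wedge (oct_e 4) (oct_e 5))" "P (wedge (oct_e 4) (oct_e 6))" "P (wedge (oct_e 4) (oct_e 7))"
    "P (wedge (oct_e 5) (oct_e 6))" "P (wedge (oct_e 5) (oct_e 7))"
    "P (wedge (oct_e 6) (oct_e 7))"
  shows "P A"
proof -
  have "\<forall>i j. P (wedge (oct_e i) (oct_e j))"
  proof -
    have flip: "P (wedge x y)" if "P (wedge y x)" for x y
      using scale[OF so8_closed(4) that, of "-1"] wedge_flip[of x y] by simp
    have refl: "P (wedge x x)" for x
      using zero by (simp add: wedge_def)
    show ?thesis unfolding forall_8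
      by (intro conjI refl base base[THEN flip])
  qed
  then have sc: "P (c *\<^sub>R wedge (oct_e i) (oct_e j))" for c i j
    by (intro scale so8_closed) auto
  have *: "P (\<Sum>i\<in>I. f i) \<and> (\<Sum>i\<in>I. f i) \<in> so8" if "finite I" "\<And>i. P (f i) \<and> f i \<in> so8"
    for I :: "8 set" and f
    using that by (induction I rule: finite_induct) (auto intro: zero add so8_closed)
  show ?thesis
    by (subst so8_expand[OF assms(1)]) (intro *[THEN conjunct1] * conjI sc so8_closed finite)
qed
definition trial3 :: "mat8 \<Rightarrow> mat8" where
  "trial3 A = (vector [
    vector [0,
      A$0$3 + A$1$2 - A$4$7 + A$5$6,
      - A$0$2 + A$1$3 + A$4$6 + A$5$7,
      A$0$5 + A$1$4 + A$2$7 - A$3$6,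
      - A$0$4 + A$1$5 - A$2$6 - A$3$7,
      - A$0$7 + A$1$6 + A$2$5 + A$3$4,
      A$0$6 + A$1$7 - A$2$4 + A$3$5,
      A$0$1 + A$2$3 + A$4$5 - A$6$7],
    vector [- A$0$3 - A$1$2 + A$4$7 - A$5$6,
      0,
      A$0$1 + A$2$3 - A$4$5 + A$6$7,
      A$0$6 - A$1$7 + A$2$4 + A$3$5,
      A$0$7 + A$1$6 + A$2$5 - A$3$4,
      - A$0$4 - A$1$5 + A$2$6 - A$3$7,
      - A$0$5 + A$1$4 + A$2$7 + A$3$6,
      A$0$2 - A$1$3 + A$4$6 + A$5$7],
    vector [A$0$2 - A$1$3 - A$4$6 - A$5$7,
      - A$0$1 - A$2$3 + A$4$5 - A$6$7,
      0,
      A$0$7 + A$1$6 - A$2$5 + A$3$4,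
      - A$0$6 + A$1$7 + A$2$4 + A$3$5,
      A$0$5 - A$1$4 + A$2$7 + A$3$6,
      - A$0$4 - A$1$5 - A$2$6 + A$3$7,
      A$0$3 + A$1$2 + A$4$7 - A$5$6],
    vector [- A$0$5 - A$1$4 - A$2$7 + A$3$6,
      - A$0$6 + A$1$7 - A$2$4 - A$3$5,
      - A$0$7 - A$1$6 + A$2$5 - A$3$4,
      0,
      A$0$1 - A$2$3 + A$4$5 + A$6$7,
      A$0$2 + A$1$3 + A$4$6 - A$5$7,
      A$0$3 - A$1$2 + A$4$7 + A$5$6,
      A$0$4 - A$1$5 - A$2$6 - A$3$7],
    vector [A$0$4 - A$1$5 + A$2$6 + A$3$7,
      - A$0$7 - A$1$6 - A$2$5 + A$3$4,
      A$0$6 - A$1$7 - A$2$4 - A$3$5,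
      - A$0$1 + A$2$3 - A$4$5 - A$6$7,
      0,
      - A$0$3 + A$1$2 + A$4$7 + A$5$6,
      A$0$2 + A$1$3 - A$4$6 + A$5$7,
      A$0$5 + A$1$4 - A$2$7 + A$3$6],
    vector [A$0$7 - A$1$6 - A$2$5 - A$3$4,
      A$0$4 + A$1$5 - A$2$6 + A$3$7,
      - A$0$5 + A$1$4 - A$2$7 - A$3$6,
      - A$0$2 - A$1$3 - A$4$6 + A$5$7,
      A$0$3 - A$1$2 - A$4$7 - A$5$6,
      0,
      - A$0$1 + A$2$3 + A$4$5 + A$6$7,
      A$0$6 + A$1$7 + A$2$4 - A$3$5],
    vector [- A$0$6 - A$1$7 + A$2$4 - A$3$5,
      A$0$5 - A$1$4 - A$2$7 - A$3$6,
      A$0$4 + A$1$5 + A$2$6 - A$3$7,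
      - A$0$3 + A$1$2 - A$4$7 - A$5$6,
      - A$0$2 - A$1$3 + A$4$6 - A$5$7,
      A$0$1 - A$2$3 - A$4$5 - A$6$7,
      0,
      A$0$7 - A$1$6 + A$2$5 + A$3$4],
    vector [- A$0$1 - A$2$3 - A$4$5 + A$6$7,
      - A$0$2 + A$1$3 - A$4$6 - A$5$7,
      - A$0$3 - A$1$2 - A$4$7 + A$5$6,
      - A$0$4 + A$1$5 + A$2$6 + A$3$7,
      - A$0$5 - A$1$4 + A$2$7 - A$3$6,
      - A$0$6 - A$1$7 - A$2$4 + A$3$5,
      - A$0$7 + A$1$6 - A$2$5 - A$3$4,
      0]])"

lemma trial3_nth:
  "trial3 A $0$0 = 0"
  "trial3 A $0$1 = - A$0$1 - A$2$3 - A$4$5 + A$6$7"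
  "trial3 A $0$2 = - A$0$2 + A$1$3 - A$4$6 - A$5$7"
  "trial3 A $0$3 = - A$0$3 - A$1$2 - A$4$7 + A$5$6"
  "trial3 A $0$4 = - A$0$4 + A$1$5 + A$2$6 + A$3$7"
  "trial3 A $0$5 = - A$0$5 - A$1$4 + A$2$7 - A$3$6"
  "trial3 A $0$6 = - A$0$6 - A$1$7 - A$2$4 + A$3$5"
  "trial3 A $0$7 = - A$0$7 + A$1$6 - A$2$5 - A$3$4"
  "trial3 A $1$0 = A$0$1 + A$2$3 + A$4$5 - A$6$7"
  "trial3 A $1$1 = 0"
  "trial3 A $1$2 = A$0$3 + A$1$2 - A$4$7 + A$5$6"
  "trial3 A $1$3 = - A$0$2 + A$1$3 + A$4$6 + A$5$7"
  "trial3 A $1$4 = A$0$5 + A$1$4 + A$2$7 - A$3$6"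
  "trial3 A $1$5 = - A$0$4 + A$1$5 - A$2$6 - A$3$7"
  "trial3 A $1$6 = - A$0$7 + A$1$6 + A$2$5 + A$3$4"
  "trial3 A $1$7 = A$0$6 + A$1$7 - A$2$4 + A$3$5"
  "trial3 A $2$0 = A$0$2 - A$1$3 + A$4$6 + A$5$7"
  "trial3 A $2$1 = - A$0$3 - A$1$2 + A$4$7 - A$5$6"
  "trial3 A $2$2 = 0"
  "trial3 A $2$3 = A$0$1 + A$2$3 - A$4$5 + A$6$7"
  "trial3 A $2$4 = A$0$6 - A$1$7 + A$2$4 + A$3$5"
  "trial3 A $2$5 = A$0$7 + A$1$6 + A$2$5 - A$3$4"
  "trial3 A $2$6 = - A$0$4 - A$1$5 + A$2$6 - A$3$7"
  "trial3 A $2$7 = - A$0$5 + A$1$4 + A$2$7 + A$3$6"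
  "trial3 A $3$0 = A$0$3 + A$1$2 + A$4$7 - A$5$6"
  "trial3 A $3$1 = A$0$2 - A$1$3 - A$4$6 - A$5$7"
  "trial3 A $3$2 = - A$0$1 - A$2$3 + A$4$5 - A$6$7"
  "trial3 A $3$3 = 0"
  "trial3 A $3$4 = A$0$7 + A$1$6 - A$2$5 + A$3$4"
  "trial3 A $3$5 = - A$0$6 + A$1$7 + A$2$4 + A$3$5"
  "trial3 A $3$6 = A$0$5 - A$1$4 + A$2$7 + A$3$6"
  "trial3 A $3$7 = - A$0$4 - A$1$5 - A$2$6 + A$3$7"
  "trial3 A $4$0 = A$0$4 - A$1$5 - A$2$6 - A$3$7"
  "trial3 A $4$1 = - A$0$5 - A$1$4 - A$2$7 + A$3$6"
  "trial3 A $4$2 = - A$0$6 + A$1$7 - A$2$4 - A$3$5"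
  "trial3 A $4$3 = - A$0$7 - A$1$6 + A$2$5 - A$3$4"
  "trial3 A $4$4 = 0"
  "trial3 A $4$5 = A$0$1 - A$2$3 + A$4$5 + A$6$7"
  "trial3 A $4$6 = A$0$2 + A$1$3 + A$4$6 - A$5$7"
  "trial3 A $4$7 = A$0$3 - A$1$2 + A$4$7 + A$5$6"
  "trial3 A $5$0 = A$0$5 + A$1$4 - A$2$7 + A$3$6"
  "trial3 A $5$1 = A$0$4 - A$1$5 + A$2$6 + A$3$7"
  "trial3 A $5$2 = - A$0$7 - A$1$6 - A$2$5 + A$3$4"
  "trial3 A $5$3 = A$0$6 - A$1$7 - A$2$4 - A$3$5"
  "trial3 A $5$4 = - A$0$1 + A$2$3 - A$4$5 - A$6$7"
  "trial3 A $5$5 = 0"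
  "trial3 A $5$6 = - A$0$3 + A$1$2 + A$4$7 + A$5$6"
  "trial3 A $5$7 = A$0$2 + A$1$3 - A$4$6 + A$5$7"
  "trial3 A $6$0 = A$0$6 + A$1$7 + A$2$4 - A$3$5"
  "trial3 A $6$1 = A$0$7 - A$1$6 - A$2$5 - A$3$4"
  "trial3 A $6$2 = A$0$4 + A$1$5 - A$2$6 + A$3$7"
  "trial3 A $6$3 = - A$0$5 + A$1$4 - A$2$7 - A$3$6"
  "trial3 A $6$4 = - A$0$2 - A$1$3 - A$4$6 + A$5$7"
  "trial3 A $6$5 = A$0$3 - A$1$2 - A$4$7 - A$5$6"
  "trial3 A $6$6 = 0"
  "trial3 A $6$7 = - A$0$1 + A$2$3 + A$4$5 + A$6$7"
  "trial3 A $7$0 = A$0$7 - A$1$6 + A$2$5 + A$3$4"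
  "trial3 A $7$1 = - A$0$6 - A$1$7 + A$2$4 - A$3$5"
  "trial3 A $7$2 = A$0$5 - A$1$4 - A$2$7 - A$3$6"
  "trial3 A $7$3 = A$0$4 + A$1$5 + A$2$6 - A$3$7"
  "trial3 A $7$4 = - A$0$3 + A$1$2 - A$4$7 - A$5$6"
  "trial3 A $7$5 = - A$0$2 - A$1$3 + A$4$6 - A$5$7"
  "trial3 A $7$6 = A$0$1 - A$2$3 - A$4$5 - A$6$7"
  "trial3 A $7$7 = 0"
  by (simp_all only: trial3_def vector_8)

lemma oct_L_nth:
  "oct_L a $0$0 = a$0"
  "oct_L a $0$1 = - a$1"
  "oct_L a $0$2 = - a$2"
  "oct_L a $0$3 = - a$3"
  "oct_L a $0$4 = - a$4"
  "oct_L a $0$5 = - a$5"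
  "oct_L a $0$6 = - a$6"
  "oct_L a $0$7 = - a$7"
  "oct_L a $1$0 = a$1"
  "oct_L a $1$1 = a$0"
  "oct_L a $1$2 = - a$3"
  "oct_L a $1$3 = a$2"
  "oct_L a $1$4 = - a$5"
  "oct_L a $1$5 = a$4"
  "oct_L a $1$6 = a$7"
  "oct_L a $1$7 = - a$6"
  "oct_L a $2$0 = a$2"
  "oct_L a $2$1 = a$3"
  "oct_L a $2$2 = a$0"
  "oct_L a $2$3 = - a$1"
  "oct_L a $2$4 = - a$6"
  "oct_L a $2$5 = - a$7"
  "oct_L a $2$6 = a$4"
  "oct_L a $2$7 = a$5"
  "oct_L a $3$0 = a$3"
  "oct_L a $3$1 = - a$2"
  "oct_L a $3$2 = a$1"
  "oct_L a $3$3 = a$0"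
  "oct_L a $3$4 = - a$7"
  "oct_L a $3$5 = a$6"
  "oct_L a $3$6 = - a$5"
  "oct_L a $3$7 = a$4"
  "oct_L a $4$0 = a$4"
  "oct_L a $4$1 = a$5"
  "oct_L a $4$2 = a$6"
  "oct_L a $4$3 = a$7"
  "oct_L a $4$4 = a$0"
  "oct_L a $4$5 = - a$1"
  "oct_L a $4$6 = - a$2"
  "oct_L a $4$7 = - a$3"
  "oct_L a $5$0 = a$5"
  "oct_L a $5$1 = - a$4"
  "oct_L a $5$2 = a$7"
  "oct_L a $5$3 = - a$6"
  "oct_L a $5$4 = a$1"
  "oct_L a $5$5 = a$0"
  "oct_L a $5$6 = a$3"
  "oct_L a $5$7 = - a$2"
  "oct_L a $6$0 = a$6"
  "oct_L a $6$1 = - a$7"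
  "oct_L a $6$2 = - a$4"
  "oct_L a $6$3 = a$5"
  "oct_L a $6$4 = a$2"
  "oct_L a $6$5 = - a$3"
  "oct_L a $6$6 = a$0"
  "oct_L a $6$7 = a$1"
  "oct_L a $7$0 = a$7"
  "oct_L a $7$1 = a$6"
  "oct_L a $7$2 = - a$5"
  "oct_L a $7$3 = - a$4"
  "oct_L a $7$4 = a$3"
  "oct_L a $7$5 = a$2"
  "oct_L a $7$6 = - a$1"
  "oct_L a $7$7 = a$0"
  by (simp_all add: oct_L_def matrix_def oct_mult_nth axis_def)

lemma trial3_so8: "trial3 A \<in> so8"
  by (simp add: so8_def transpose_def vec_eq_iff forall_8 trial3_nth)

lemma trial2_trial2: "trial2 (trial2 A) = 2 *\<^sub>R trial3 A"
  by (simp add: vec_eq_iff forall_8 trial2_nth trial3_nth)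

lemma trial2_trial3: "A \<in> so8 \<Longrightarrow> trial2 (trial3 A) = 4 *\<^sub>R A"
  by (simp add: vec_eq_iff forall_8 trial2_nth trial3_nth so8_nth)

lemma trial2_linear:
  "trial2 (A + B) = trial2 A + trial2 B" "trial2 (c *\<^sub>R A) = c *\<^sub>R trial2 A"
  by (simp_all add: vec_eq_iff forall_8 trial2_nth algebra_simps)

lemma oct_cnj_nth:
  "oct_cnj x $ 0 = x$0" "oct_cnj x $ 1 = - x$1" "oct_cnj x $ 2 = - x$2" "oct_cnj x $ 3 = - x$3"
  "oct_cnj x $ 4 = - x$4" "oct_cnj x $ 5 = - x$5" "oct_cnj x $ 6 = - x$6" "oct_cnj x $ 7 = - x$7"
  by (simp_all add: oct_cnj_def)

lemma trial2_wedge: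
  assumes "a $ 0 = 0" "a \<bullet> b = 0"
  shows "trial2 (wedge a b) = oct_L (oct_cnj b) ** oct_L (oct_cnj a)"
proof -
  have "a $ 1 * b $ 1 = - (a $ 2 * b $ 2 + a $ 3 * b $ 3 + a $ 4 * b $ 4 + a $ 5 * b $ 5 + a $ 6 * b $ 6 + a $ 7 * b $ 7)"
    using assms by (simp add: inner_vec_def sum_8)
  then show ?thesis
    by (simp add: vec_eq_iff forall_8 matrix_matrix_mult_def sum_8 trial2_nth wedge_nth oct_L_nth oct_cnj_nth assms(1) mult.commute[of "b$_"])
qed

lemma matrix_e: "(M *v oct_e i) $ k = M $ k $ i" for M :: mat8
  by (simp add: matrix_vector_mult_def oct_e_nth)

lemma oct_mult_e:
  "(x \<odot> oct_e 0) $ 0 = x$0"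
  "(oct_e 0 \<odot> x) $ 0 = x$0"
  "(x \<odot> oct_e 0) $ 1 = x$1"
  "(oct_e 0 \<odot> x) $ 1 = x$1"
  "(x \<odot> oct_e 0) $ 2 = x$2"
  "(oct_e 0 \<odot> x) $ 2 = x$2"
  "(x \<odot> oct_e 0) $ 3 = x$3"
  "(oct_e 0 \<odot> x) $ 3 = x$3"
  "(x \<odot> oct_e 0) $ 4 = x$4"
  "(oct_e 0 \<odot> x) $ 4 = x$4"
  "(x \<odot> oct_e 0) $ 5 = x$5"
  "(oct_e 0 \<odot> x) $ 5 = x$5"
  "(x \<odot> oct_e 0) $ 6 = x$6"
  "(oct_e 0 \<odot> x) $ 6 = x$6"
  "(x \<odot> oct_e 0) $ 7 = x$7"
  "(oct_e 0 \<odot> x) $ 7 = x$7"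
  "(x \<odot> oct_e 1) $ 0 = - x$1"
  "(oct_e 1 \<odot> x) $ 0 = - x$1"
  "(x \<odot> oct_e 1) $ 1 = x$0"
  "(oct_e 1 \<odot> x) $ 1 = x$0"
  "(x \<odot> oct_e 1) $ 2 = x$3"
  "(oct_e 1 \<odot> x) $ 2 = - x$3"
  "(x \<odot> oct_e 1) $ 3 = - x$2"
  "(oct_e 1 \<odot> x) $ 3 = x$2"
  "(x \<odot> oct_e 1) $ 4 = x$5"
  "(oct_e 1 \<odot> x) $ 4 = - x$5"
  "(x \<odot> oct_e 1) $ 5 = - x$4"
  "(oct_e 1 \<odot> x) $ 5 = x$4"
  "(x \<odot> oct_e 1) $ 6 = - x$7"
  "(oct_e 1 \<odot> x) $ 6 = x$7"
  "(x \<odot> oct_e 1) $ 7 = x$6"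
  "(oct_e 1 \<odot> x) $ 7 = - x$6"
  "(x \<odot> oct_e 2) $ 0 = - x$2"
  "(oct_e 2 \<odot> x) $ 0 = - x$2"
  "(x \<odot> oct_e 2) $ 1 = - x$3"
  "(oct_e 2 \<odot> x) $ 1 = x$3"
  "(x \<odot> oct_e 2) $ 2 = x$0"
  "(oct_e 2 \<odot> x) $ 2 = x$0"
  "(x \<odot> oct_e 2) $ 3 = x$1"
  "(oct_e 2 \<odot> x) $ 3 = - x$1"
  "(x \<odot> oct_e 2) $ 4 = x$6"
  "(oct_e 2 \<odot> x) $ 4 = - x$6"
  "(x \<odot> oct_e 2) $ 5 = x$7"
  "(oct_e 2 \<odot> x) $ 5 = - x$7"
  "(x \<odot> oct_e 2) $ 6 = - x$4"
  "(oct_e 2 \<odot> x) $ 6 = x$4"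
  "(x \<odot> oct_e 2) $ 7 = - x$5"
  "(oct_e 2 \<odot> x) $ 7 = x$5"
  "(x \<odot> oct_e 3) $ 0 = - x$3"
  "(oct_e 3 \<odot> x) $ 0 = - x$3"
  "(x \<odot> oct_e 3) $ 1 = x$2"
  "(oct_e 3 \<odot> x) $ 1 = - x$2"
  "(x \<odot> oct_e 3) $ 2 = - x$1"
  "(oct_e 3 \<odot> x) $ 2 = x$1"
  "(x \<odot> oct_e 3) $ 3 = x$0"
  "(oct_e 3 \<odot> x) $ 3 = x$0"
  "(x \<odot> oct_e 3) $ 4 = x$7"
  "(oct_e 3 \<odot> x) $ 4 = - x$7"
  "(x \<odot> oct_e 3) $ 5 = - x$6"
  "(oct_e 3 \<odot> x) $ 5 = x$6"
  "(x \<odot> oct_e 3) $ 6 = x$5"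
  "(oct_e 3 \<odot> x) $ 6 = - x$5"
  "(x \<odot> oct_e 3) $ 7 = - x$4"
  "(oct_e 3 \<odot> x) $ 7 = x$4"
  "(x \<odot> oct_e 4) $ 0 = - x$4"
  "(oct_e 4 \<odot> x) $ 0 = - x$4"
  "(x \<odot> oct_e 4) $ 1 = - x$5"
  "(oct_e 4 \<odot> x) $ 1 = x$5"
  "(x \<odot> oct_e 4) $ 2 = - x$6"
  "(oct_e 4 \<odot> x) $ 2 = x$6"
  "(x \<odot> oct_e 4) $ 3 = - x$7"
  "(oct_e 4 \<odot> x) $ 3 = x$7"
  "(x \<odot> oct_e 4) $ 4 = x$0"
  "(oct_e 4 \<odot> x) $ 4 = x$0"
  "(x \<odot> oct_e 4) $ 5 = x$1"
  "(oct_e 4 \<odot> x) $ 5 = - x$1"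
  "(x \<odot> oct_e 4) $ 6 = x$2"
  "(oct_e 4 \<odot> x) $ 6 = - x$2"
  "(x \<odot> oct_e 4) $ 7 = x$3"
  "(oct_e 4 \<odot> x) $ 7 = - x$3"
  "(x \<odot> oct_e 5) $ 0 = - x$5"
  "(oct_e 5 \<odot> x) $ 0 = - x$5"
  "(x \<odot> oct_e 5) $ 1 = x$4"
  "(oct_e 5 \<odot> x) $ 1 = - x$4"
  "(x \<odot> oct_e 5) $ 2 = - x$7"
  "(oct_e 5 \<odot> x) $ 2 = x$7"
  "(x \<odot> oct_e 5) $ 3 = x$6"
  "(oct_e 5 \<odot> x) $ 3 = - x$6"
  "(x \<odot> oct_e 5) $ 4 = - x$1"
  "(oct_e 5 \<odot> x) $ 4 = x$1"
  "(x \<odot> oct_e 5) $ 5 = x$0"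
  "(oct_e 5 \<odot> x) $ 5 = x$0"
  "(x \<odot> oct_e 5) $ 6 = - x$3"
  "(oct_e 5 \<odot> x) $ 6 = x$3"
  "(x \<odot> oct_e 5) $ 7 = x$2"
  "(oct_e 5 \<odot> x) $ 7 = - x$2"
  "(x \<odot> oct_e 6) $ 0 = - x$6"
  "(oct_e 6 \<odot> x) $ 0 = - x$6"
  "(x \<odot> oct_e 6) $ 1 = x$7"
  "(oct_e 6 \<odot> x) $ 1 = - x$7"
  "(x \<odot> oct_e 6) $ 2 = x$4"
  "(oct_e 6 \<odot> x) $ 2 = - x$4"
  "(x \<odot> oct_e 6) $ 3 = - x$5"
  "(oct_e 6 \<odot> x) $ 3 = x$5"
  "(x \<odot> oct_e 6) $ 4 = - x$2"
  "(oct_e 6 \<odot> x) $ 4 = x$2"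
  "(x \<odot> oct_e 6) $ 5 = x$3"
  "(oct_e 6 \<odot> x) $ 5 = - x$3"
  "(x \<odot> oct_e 6) $ 6 = x$0"
  "(oct_e 6 \<odot> x) $ 6 = x$0"
  "(x \<odot> oct_e 6) $ 7 = - x$1"
  "(oct_e 6 \<odot> x) $ 7 = x$1"
  "(x \<odot> oct_e 7) $ 0 = - x$7"
  "(oct_e 7 \<odot> x) $ 0 = - x$7"
  "(x \<odot> oct_e 7) $ 1 = - x$6"
  "(oct_e 7 \<odot> x) $ 1 = x$6"
  "(x \<odot> oct_e 7) $ 2 = x$5"
  "(oct_e 7 \<odot> x) $ 2 = - x$5"
  "(x \<odot> oct_e 7) $ 3 = x$4"
  "(oct_e 7 \<odot> x) $ 3 = - x$4"
  "(x \<odot> oct_e 7) $ 4 = - x$3"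
  "(oct_e 7 \<odot> x) $ 4 = x$3"
  "(x \<odot> oct_e 7) $ 5 = - x$2"
  "(oct_e 7 \<odot> x) $ 5 = x$2"
  "(x \<odot> oct_e 7) $ 6 = x$1"
  "(oct_e 7 \<odot> x) $ 6 = - x$1"
  "(x \<odot> oct_e 7) $ 7 = x$0"
  "(oct_e 7 \<odot> x) $ 7 = x$0"
  by (simp_all add: oct_mult_nth oct_e_nth)

lemma oct_ee:
  "oct_e 0 \<odot> oct_e 0 = oct_e 0"
  "oct_e 0 \<odot> oct_e 1 = oct_e 1"
  "oct_e 0 \<odot> oct_e 2 = oct_e 2"
  "oct_e 0 \<odot> oct_e 3 = oct_e 3"
  "oct_e 0 \<odot> oct_e 4 = oct_e 4"
  "oct_e 0 \<odot> oct_e 5 = oct_e 5"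
  "oct_e 0 \<odot> oct_e 6 = oct_e 6"
  "oct_e 0 \<odot> oct_e 7 = oct_e 7"
  "oct_e 1 \<odot> oct_e 0 = oct_e 1"
  "oct_e 1 \<odot> oct_e 1 = - oct_e 0"
  "oct_e 1 \<odot> oct_e 2 = oct_e 3"
  "oct_e 1 \<odot> oct_e 3 = - oct_e 2"
  "oct_e 1 \<odot> oct_e 4 = oct_e 5"
  "oct_e 1 \<odot> oct_e 5 = - oct_e 4"
  "oct_e 1 \<odot> oct_e 6 = - oct_e 7"
  "oct_e 1 \<odot> oct_e 7 = oct_e 6"
  "oct_e 2 \<odot> oct_e 0 = oct_e 2"
  "oct_e 2 \<odot> oct_e 1 = - oct_e 3"
  "oct_e 2 \<odot> oct_e 2 = - oct_e 0"
  "oct_e 2 \<odot> oct_e 3 = oct_e 1"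
  "oct_e 2 \<odot> oct_e 4 = oct_e 6"
  "oct_e 2 \<odot> oct_e 5 = oct_e 7"
  "oct_e 2 \<odot> oct_e 6 = - oct_e 4"
  "oct_e 2 \<odot> oct_e 7 = - oct_e 5"
  "oct_e 3 \<odot> oct_e 0 = oct_e 3"
  "oct_e 3 \<odot> oct_e 1 = oct_e 2"
  "oct_e 3 \<odot> oct_e 2 = - oct_e 1"
  "oct_e 3 \<odot> oct_e 3 = - oct_e 0"
  "oct_e 3 \<odot> oct_e 4 = oct_e 7"
  "oct_e 3 \<odot> oct_e 5 = - oct_e 6"
  "oct_e 3 \<odot> oct_e 6 = oct_e 5"
  "oct_e 3 \<odot> oct_e 7 = - oct_e 4"
  "oct_e 4 \<odot> oct_e 0 = oct_e 4"
  "oct_e 4 \<odot> oct_e 1 = - oct_e 5"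
  "oct_e 4 \<odot> oct_e 2 = - oct_e 6"
  "oct_e 4 \<odot> oct_e 3 = - oct_e 7"
  "oct_e 4 \<odot> oct_e 4 = - oct_e 0"
  "oct_e 4 \<odot> oct_e 5 = oct_e 1"
  "oct_e 4 \<odot> oct_e 6 = oct_e 2"
  "oct_e 4 \<odot> oct_e 7 = oct_e 3"
  "oct_e 5 \<odot> oct_e 0 = oct_e 5"
  "oct_e 5 \<odot> oct_e 1 = oct_e 4"
  "oct_e 5 \<odot> oct_e 2 = - oct_e 7"
  "oct_e 5 \<odot> oct_e 3 = oct_e 6"
  "oct_e 5 \<odot> oct_e 4 = - oct_e 1"
  "oct_e 5 \<odot> oct_e 5 = - oct_e 0"
  "oct_e 5 \<odot> oct_e 6 = - oct_e 3"
  "oct_e 5 \<odot> oct_e 7 = oct_e 2"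
  "oct_e 6 \<odot> oct_e 0 = oct_e 6"
  "oct_e 6 \<odot> oct_e 1 = oct_e 7"
  "oct_e 6 \<odot> oct_e 2 = oct_e 4"
  "oct_e 6 \<odot> oct_e 3 = - oct_e 5"
  "oct_e 6 \<odot> oct_e 4 = - oct_e 2"
  "oct_e 6 \<odot> oct_e 5 = oct_e 3"
  "oct_e 6 \<odot> oct_e 6 = - oct_e 0"
  "oct_e 6 \<odot> oct_e 7 = - oct_e 1"
  "oct_e 7 \<odot> oct_e 0 = oct_e 7"
  "oct_e 7 \<odot> oct_e 1 = - oct_e 6"
  "oct_e 7 \<odot> oct_e 2 = oct_e 5"
  "oct_e 7 \<odot> oct_e 3 = oct_e 4"
  "oct_e 7 \<odot> oct_e 4 = - oct_e 3"
  "oct_e 7 \<odot> oct_e 5 = - oct_e 2"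
  "oct_e 7 \<odot> oct_e 6 = oct_e 1"
  "oct_e 7 \<odot> oct_e 7 = - oct_e 0"
  by (simp_all add: vec_eq_iff forall_8 oct_mult_e oct_e_nth)

lemma oct_cnj_e:
  "oct_cnj (oct_e 0) = oct_e 0"
  "oct_cnj (- oct_e 0) = - oct_e 0"
  "oct_cnj (oct_e 1) = - oct_e 1"
  "oct_cnj (- oct_e 1) = oct_e 1"
  "oct_cnj (oct_e 2) = - oct_e 2"
  "oct_cnj (- oct_e 2) = oct_e 2"
  "oct_cnj (oct_e 3) = - oct_e 3"
  "oct_cnj (- oct_e 3) = oct_e 3"
  "oct_cnj (oct_e 4) = - oct_e 4"
  "oct_cnj (- oct_e 4) = oct_e 4"
  "oct_cnj (oct_e 5) = - oct_e 5"
  "oct_cnj (- oct_e 5) = oct_e 5"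
  "oct_cnj (oct_e 6) = - oct_e 6"
  "oct_cnj (- oct_e 6) = oct_e 6"
  "oct_cnj (oct_e 7) = - oct_e 7"
  "oct_cnj (- oct_e 7) = oct_e 7"
  by (simp_all add: vec_eq_iff forall_8 oct_cnj_nth oct_e_nth)

lemma matrix_vector_mult_neg: "M *v (- x) = - (M *v x)" for M :: mat8
  by (simp add: vec_eq_iff matrix_vector_mult_def sum_negf)

text \<open>The infinitesimal triality principle, from which it follows that \<^const>\<open>trial2\<close> is, up to
  the factor 2, compatible with brackets.\<close>

lemma triality_principle_basis:
  assumes "A \<in> so8"
  shows "(trial2 A *v oct_e i) \<odot> oct_e j + oct_e i \<odot> (trial3 A *v oct_e j) = 2 *\<^sub>R oct_cnj (A *v oct_cnj (oct_e i \<odot> oct_e j))"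
proof -
  have "\<forall>i j. (trial2 A *v oct_e i) \<odot> oct_e j + oct_e i \<odot> (trial3 A *v oct_e j) = 2 *\<^sub>R oct_cnj (A *v oct_cnj (oct_e i \<odot> oct_e j))"
    unfolding forall_8
    apply (simp only: oct_ee oct_cnj_e matrix_vector_mult_neg)
    apply (simp only: vec_eq_iff forall_8)
    apply (simp only: vector_add_component vector_scaleR_component oct_mult_e matrix_e oct_cnj_nth trial2_nth trial3_nth so8_nth[OF assms] vector_uminus_component)
    by simp
  then show ?thesis by blast
qed

lemma bilinear_oct_mult: "bilinear (\<odot>)"
  by (simp add: bilinear_def linear_iff vec_eq_iff forall_8 oct_mult_nth algebra_simps)

lemma linear_oct_cnj: "linear oct_cnj"
  by (simp add: linear_iff vec_eq_iff oct_cnj_def)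

lemma triality_principle:
  assumes "A \<in> so8"
  shows "(trial2 A *v x) \<odot> y + x \<odot> (trial3 A *v y) = 2 *\<^sub>R oct_cnj (A *v oct_cnj (x \<odot> y))"
proof -
  note bl = bilinear_ladd[OF bilinear_oct_mult] bilinear_radd[OF bilinear_oct_mult]
    bilinear_lmul[OF bilinear_oct_mult] bilinear_rmul[OF bilinear_oct_mult]
    linear_add[OF linear_oct_cnj] linear_cmul[OF linear_oct_cnj]
  have "(\<lambda>x y. (trial2 A *v x) \<odot> y + x \<odot> (trial3 A *v y)) =
      (\<lambda>x y. 2 *\<^sub>R oct_cnj (A *v oct_cnj (x \<odot> y)))"
  proof (rule bilinear_eq_stdbasis)
    show "bilinear (\<lambda>x y. (trial2 A *v x) \<odot> y + x \<odot> (trial3 A *v y))"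
      by (simp add: bilinear_def linear_iff bl matrix_vector_right_distrib matrix_vector_mult_scaleR
          scaleR_add_right add_ac)
    show "bilinear (\<lambda>x y. 2 *\<^sub>R oct_cnj (A *v oct_cnj (x \<odot> y)))"
      by (simp add: bilinear_def linear_iff bl matrix_vector_right_distrib matrix_vector_mult_scaleR
          scaleR_add_right)
  next
    fix b c :: oct
    assume "b \<in> Basis" "c \<in> Basis"
    then obtain i j where "b = oct_e i" "c = oct_e j"
      by (auto simp: Basis_vec_def oct_e_def)
    then show "(trial2 A *v b) \<odot> c + b \<odot> (trial3 A *v c) = 2 *\<^sub>R oct_cnj (A *v oct_cnj (b \<odot> c))"
      using triality_principle_basis[OF assms] by simp
  qed
  then show ?thesis by metis
qed

lemma so8_derivation_zero:
  assumes "D \<in> so8" "E \<in> so8" and der: "\<And>x y. (D *v x) \<odot> y + x \<odot> (E *v y) = 0"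
  shows "D = 0"
proof -
  define d where "d = E *v oct_e 0"
  have D: "D *v x = - (x \<odot> d)" for x
    using der[of x "oct_e 0"] by (simp add: d_def oct_products eq_neg_iff_add_eq_0)
  have E: "E *v y = d \<odot> y" for y
    using der[of "oct_e 0" y] D[of "oct_e 0"]
    by (simp add: oct_products bilinear_lneg[OF bilinear_oct_mult])
  have d0: "d $ 0 = 0"
    using so8_nth[OF assms(2)] by (simp add: d_def matrix_e)
  have as: "(x \<odot> d) \<odot> y = x \<odot> (d \<odot> y)" for x y
    using der[of x y] by (simp add: D E bilinear_lneg[OF bilinear_oct_mult])
  have "d = 0"
    using as[of "oct_e 1" "oct_e 2"] as[of "oct_e 1" "oct_e 4"] as[of "oct_e 2" "oct_e 4"] d0
    by (simp add: vec_eq_iff forall_8 oct_mult_e)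
  then have "D *v x = 0 *v x" for x
    by (simp add: D bilinear_rzero[OF bilinear_oct_mult])
  then show ?thesis by (simp add: matrix_eq)
qed

lemma mat_bracket_apply: "mat_bracket A B *v x = A *v (B *v x) - B *v (A *v x)"
  by (simp add: mat_bracket_def matrix_vector_mult_diff_rdistrib matrix_vector_mul_assoc)

lemma so8_diff: "A \<in> so8 \<Longrightarrow> B \<in> so8 \<Longrightarrow> A - B \<in> so8"
  by (simp add: so8_def transpose_diff)

lemma trial2_hom:
  assumes A: "A \<in> so8" and B: "B \<in> so8"
  shows "mat_bracket (trial2 A) (trial2 B) = 2 *\<^sub>R trial2 (mat_bracket A B)"
proof -
  note bl = bilinear_ladd[OF bilinear_oct_mult] bilinear_radd[OF bilinear_oct_mult]
    bilinear_lsub[OF bilinear_oct_mult] bilinear_rsub[OF bilinear_oct_mult]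
    bilinear_lmul[OF bilinear_oct_mult] bilinear_rmul[OF bilinear_oct_mult]
  define k where "k = (\<lambda>M z. oct_cnj (M *v oct_cnj z))"
  have k_lin: "k M (x - y) = k M x - k M y" "k M (c *\<^sub>R x) = c *\<^sub>R k M x" for M x y c
    by (simp_all add: k_def linear_diff[OF linear_oct_cnj] linear_cmul[OF linear_oct_cnj]
        matrix_vector_mult_diff_distrib matrix_vector_mult_scaleR)
  have cc: "oct_cnj (oct_cnj x) = x" for x by (simp add: vec_eq_iff oct_cnj_def)
  have k_br: "k (mat_bracket A B) z = k A (k B z) - k B (k A z)" for z
    by (simp add: k_def mat_bracket_apply cc linear_diff[OF linear_oct_cnj])
  have tri: "(trial2 M *v x) \<odot> y = 2 *\<^sub>R k M (x \<odot> y) - x \<odot> (trial3 M *v y)" if "M \<in> so8" for M x y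
    using triality_principle[OF that, of x y] by (simp add: k_def algebra_simps)
  let ?C = "mat_bracket A B"
  have C: "?C \<in> so8" using A B by (rule mat_bracket_so8)
  have "mat_bracket (trial2 A) (trial2 B) - 2 *\<^sub>R trial2 ?C = 0"
  proof (rule so8_derivation_zero)
    show "mat_bracket (trial2 A) (trial2 B) - 2 *\<^sub>R trial2 ?C \<in> so8"
      by (intro so8_diff mat_bracket_so8 trial2_so8 so8_closed)
    show "mat_bracket (trial3 A) (trial3 B) - 2 *\<^sub>R trial3 ?C \<in> so8"
      by (intro so8_diff mat_bracket_so8 trial3_so8 so8_closed)
  next
    fix x y
    have "(mat_bracket (trial2 A) (trial2 B) *v x) \<odot> y =
        4 *\<^sub>R k ?C (x \<odot> y) - x \<odot> (mat_bracket (trial3 A) (trial3 B) *v y)"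
      by (simp add: mat_bracket_apply bl tri[OF A] tri[OF B] k_lin k_br algebra_simps)
    moreover have "2 *\<^sub>R ((trial2 ?C *v x) \<odot> y) = 4 *\<^sub>R k ?C (x \<odot> y) - 2 *\<^sub>R (x \<odot> (trial3 ?C *v y))"
      by (simp add: tri[OF C] scaleR_diff_right)
    ultimately show "((mat_bracket (trial2 A) (trial2 B) - 2 *\<^sub>R trial2 ?C) *v x) \<odot> y +
        x \<odot> ((mat_bracket (trial3 A) (trial3 B) - 2 *\<^sub>R trial3 ?C) *v y) = 0"
      by (simp add: matrix_vector_mult_diff_rdistrib bl scaleR_matrix_vector_assoc[symmetric] algebra_simps)
  qed
  then show ?thesis by simp
qed

lemma oct_Pu_nth: "a \<in> oct_Pu \<Longrightarrow> a $ 0 = 0"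
  unfolding oct_Pu_def by (induction rule: span_induct) (auto simp: subspace_def oct_e_nth)

lemma e_in_Pu: "i \<noteq> 0 \<Longrightarrow> oct_e i \<in> oct_Pu"
  using exhaust_8[of i] by (auto simp: oct_Pu_def intro: span_base)

lemma is_triality_trial2: "is_triality (\<lambda>A. (1/2) *\<^sub>R trial2 A)" (is "is_triality ?f")
proof -
  have so: "?f A \<in> so8" for A by (intro so8_closed trial2_so8)
  have three: "?f (?f (?f A)) = A" if "A \<in> so8" for A
    using that by (simp add: trial2_linear trial2_trial2 trial2_trial3)
  have "bij_betw ?f so8 so8"
    by (rule bij_betwI[where g = "\<lambda>A. ?f (?f A)"]) (use so three in auto)
  moreover have "?f (mat_bracket A B) = mat_bracket (?f A) (?f B)" if "A \<in> so8" "B \<in> so8" for A B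
  proof -
    have "mat_bracket (?f A) (?f B) = (1/4) *\<^sub>R mat_bracket (trial2 A) (trial2 B)"
      by (simp add: mat_bracket_def vec_eq_iff matrix_matrix_mult_def sum_divide_distrib diff_divide_distrib)
    then show ?thesis by (simp add: trial2_hom[OF that])
  qed
  moreover have "?f (wedge (oct_e 0) (oct_e 1)) \<noteq> wedge (oct_e 0) (oct_e 1)"
  proof
    assume "?f (wedge (oct_e 0) (oct_e 1)) = wedge (oct_e 0) (oct_e 1)"
    then have "?f (wedge (oct_e 0) (oct_e 1)) $ 0 $ 1 = wedge (oct_e 0) (oct_e 1) $ 0 $ 1" by simp
    then show False by (simp add: trial2_nth wedge_nth oct_e_nth)
  qed
  ultimately show ?thesis
    using three so8_closed(4)
    by (auto simp: is_triality_def so8_automorphism_def trial2_linear scaleR_add_right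
        trial2_wedge oct_Pu_nth)
qed

lemma is_triality_unique:
  assumes f: "is_triality f" and g: "is_triality g" and A: "A \<in> so8"
  shows "f A = g A"
proof -
  have add: "h (A + B) = h A + h B" and scale: "h (c *\<^sub>R A) = c *\<^sub>R h A"
    if "is_triality h" "A \<in> so8" "B \<in> so8" for h A B c
    using that by (auto simp: is_triality_def so8_automorphism_def)
  have base: "h (wedge a b) = (1/2) *\<^sub>R (oct_L (oct_cnj b) ** oct_L (oct_cnj a))"
    if "is_triality h" "a \<in> oct_Pu" "a \<bullet> b = 0" for h a b
    using that by (auto simp: is_triality_def)
  have orth: "oct_e i \<bullet> oct_e j = 0" if "i \<noteq> j" for i j
    using that by (simp add: oct_e_def inner_axis_axis)
  have ne: "f (wedge (oct_e i) (oct_e j)) = g (wedge (oct_e i) (oct_e j))" if "i \<noteq> 0" "i \<noteq> j" for i j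
    using base[OF f e_in_Pu orth] base[OF g e_in_Pu orth] that by simp
  have flip: "h (wedge a b) = (- 1) *\<^sub>R h (wedge b a)" if "is_triality h" for h a b
    by (subst wedge_flip) (rule scale[OF that so8_closed(4) so8_closed(4)])
  have z: "f (wedge (oct_e 0) (oct_e j)) = g (wedge (oct_e 0) (oct_e j))" if "j \<noteq> 0" for j
    using ne[of j 0] that flip[OF f] flip[OF g] by metis
  show ?thesis
  proof (rule so8_induct[OF A, of "\<lambda>A. f A = g A"])
    show "f 0 = g 0"
      using scale[OF f so8_closed(1,1), of 0] scale[OF g so8_closed(1,1), of 0] by simp
  qed (simp_all add: add[OF f] add[OF g] scale[OF f _ so8_closed(1)] scale[OF g _ so8_closed(1)] ne z)
qed

theorem triality_ex1: "\<exists>!f. f \<in> extensional so8 \<and> is_triality f"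
proof -
  define t where "t = restrict (\<lambda>A. (1/2) *\<^sub>R trial2 A) so8"
  have t: "t A = (1/2) *\<^sub>R trial2 A" if "A \<in> so8" for A using that by (simp add: t_def)
  have "is_triality t \<longleftrightarrow> is_triality (\<lambda>A. (1/2) *\<^sub>R trial2 A)"
    unfolding is_triality_def so8_automorphism_def
    by (simp add: t so8_closed trial2_so8 mat_bracket_so8 cong: bij_betw_cong)
  then have t_tri: "is_triality t" using is_triality_trial2 by simp
  show ?thesis
  proof (rule ex1I[of _ t])
    show "t \<in> extensional so8 \<and> is_triality t" using t_tri by (simp add: t_def)
    show "f = t" if "f \<in> extensional so8 \<and> is_triality f" for f
    proof (rule extensionalityI[of f so8 t])
      show "t \<in> extensional so8" by (simp add: t_def)
    qed (use that is_triality_unique t_tri in auto)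
  qed
qed

lemma is_triality_triality: "is_triality triality"
  using theI'[OF triality_ex1] by (simp add: triality_def)


section \<open>Multiplication and conjugation of pure tensors\<close>

lemma oct_basis_mult_nth: "(oct_e i \<odot> oct_e k) $ p = oct_coeff i k p"
proof -
  have em: "oct_e m $ j = of_bool (j = m)" for m j by (auto simp: oct_e_nth)
  show ?thesis
    by (simp only: oct_mult_def vec_lambda_beta em mult.assoc[symmetric] sum_distrib_right[symmetric] sum_pick)
qed

lemma oo_mult_outer: "outer a b \<star> outer c d = outer (a \<odot> c) (b \<odot> d)"
proof -
  have "(outer a b \<star> outer c d) $ p $ q = outer (a \<odot> c) (b \<odot> d) $ p $ q" for p q
  proof -
    have "(outer a b \<star> outer c d) $ p $ q = (\<Sum>i\<in>UNIV. \<Sum>j\<in>UNIV. \<Sum>k\<in>UNIV. \<Sum>l\<in>UNIV.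
        (oct_coeff i k p * (a$i * c$k)) * (oct_coeff j l q * (b$j * d$l)))"
      by (simp add: oo_mult_def outer_def oct_basis_mult_nth mult_ac)
    also have "\<dots> = (\<Sum>i\<in>UNIV. \<Sum>k\<in>UNIV. \<Sum>j\<in>UNIV. \<Sum>l\<in>UNIV.
        (oct_coeff i k p * (a$i * c$k)) * (oct_coeff j l q * (b$j * d$l)))"
      by (intro sum.cong refl sum.swap)
    also have "\<dots> = outer (a \<odot> c) (b \<odot> d) $ p $ q"
      by (simp only: outer_def oct_mult_def vec_lambda_beta sum_distrib_left[symmetric] sum_distrib_right[symmetric])
    finally show ?thesis .
  qed
  then show ?thesis by (simp add: vec_eq_iff)
qed

lemma oo_cnj_nth: "oo_cnj X $ p $ q = (if p = 0 then 1 else -1) * (if q = 0 then 1 else -1) * X $ p $ q"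
proof -
  have c: "oct_cnj (oct_e i) $ p = (if p = 0 then 1 else -1) * of_bool (i = p)" for i p
    by (simp add: oct_cnj_def oct_e_nth)
  have "oo_cnj X $ p $ q = (\<Sum>i\<in>UNIV. \<Sum>j\<in>UNIV. (if p = 0 then 1 else -1) * (if q = 0 then 1 else -1) * X $ i $ j * of_bool (i = p) * of_bool (j = q))"
    by (simp add: oo_cnj_def outer_def c mult_ac)
  then show ?thesis
    by (simp only: mult.assoc[symmetric] sum_distrib_right[symmetric] sum_pick)
qed

lemma oo_cnj_outer: "oo_cnj (outer a b) = outer (oct_cnj a) (oct_cnj b)"
  by (simp add: vec_eq_iff oo_cnj_nth) (simp add: outer_def oct_cnj_def)

lemma t2_subset_so8: "t2 \<subseteq> so8"
  unfolding t2_def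
proof (rule span_minimal)
  show "subspace so8" by (simp add: subspace_def so8_closed)
  have "oct_L (oct_e 1) \<in> so8" "oct_R (oct_e 1) \<in> so8"
    by (simp_all add: so8_def transpose_def vec_eq_iff forall_8 oct_L_def oct_R_def matrix_def
        oct_mult_e axis_def oct_e_nth)
  then show "{oct_L (oct_e 1), oct_R (oct_e 1)} \<subseteq> so8" by simp
qed

lemma e6_subset_e8: "e6 \<subseteq> e8"
  using t2_subset_so8 by (auto simp: e6_def e8_def)

lemma f4_subset_e6: "f4 \<subseteq> e6"
proof -
  have "oct_e 0 \<in> oct_C" by (simp add: oct_C_def span_base)
  then have "outer u (oct_e 0) \<in> OC" for u
    unfolding OC_def by (intro span_base) auto
  moreover have "0 \<in> t2" by (simp add: t2_def span_zero)
  ultimately show ?thesis by (auto simp: f4_def e6_def)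
qed

end

theory Submission
  imports Defs
begin

text \<open>
  Everything rests on how triality permutes the torus \<^const>\<open>t2\<close>. On it,
  \<open>\<lambda>(L) = R\<close> and \<open>\<lambda>(R) = - (L + R)\<close>, where \<open>L\<close> and \<open>R\<close> are left and right multiplication by
  \<open>e\<^sub>1\<close>, while the rotation in the plane \<open>\<complex>\<close> is \<open>e\<^sub>0 \<and> e\<^sub>1 = - (L + R) / 2\<close>; so the plane rotation
  and its two triality images are \<open>- (L + R) / 2\<close>, \<open>L / 2\<close> and \<open>R / 2\<close>.

  In the bracket of \<open>(A, u, v, w)\<close> with \<open>(t, s, x, y, z)\<close> every tensor on the left has second
  factor \<open>e\<^sub>0\<close> and every tensor on the right has second factor \<open>e\<^sub>1\<close>. As \<open>e\<^sub>0\<close> and \<open>e\<^sub>1\<close> are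
  orthogonal, \<open>(u \<otimes> e\<^sub>0) \<curlywedge> (x \<otimes> e\<^sub>1)\<close> is just \<open>\<langle>u, x\<rangle> e\<^sub>0 \<and> e\<^sub>1\<close> in the second copy of \<open>so(8)\<close>, and
  the three images above give the torus part. An element \<open>tL + sR\<close> of the torus acts on \<open>u \<otimes> e\<^sub>0\<close>
  through \<open>e\<^sub>0\<^sup>t (tL + sR) = - (t + s) e\<^sub>1\<^sup>t\<close>; applying triality first replaces \<open>(t, s)\<close> by
  \<open>(- s, t - s)\<close>, and once more by \<open>(s - t, - t)\<close>, which yields the three different
  coefficients. The products cause no difficulty: conjugating \<open>vz \<otimes> e\<^sub>1\<close> turns the second factor
  into \<open>- e\<^sub>1\<close>, which is the source of the signs in front of the octonion products.

  For the orthogonal complement, write a member of \<open>\<O> \<otimes> \<complex>\<close> as \<open>a \<otimes> e\<^sub>0 + b \<otimes> e\<^sub>1\<close>: pairing it with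
  \<open>u \<otimes> e\<^sub>0\<close> leaves \<open>\<langle>a, u\<rangle>\<close>, and \<open>- tr (A C)\<close> is the Frobenius product on \<open>so(8)\<close>, so that
  orthogonality to \<^const>\<open>f4\<close> kills exactly the \<open>so(8)\<close> part and the three \<open>a\<close>'s.
\<close>


section \<open>Triality on the torus\<close>

abbreviation L1 :: mat8 where "L1 \<equiv> oct_L (oct_e 1)"
abbreviation R1 :: mat8 where "R1 \<equiv> oct_R (oct_e 1)"

text \<open>The defining relation fixes triality on a spanning set only; this explicit formula makes it
  computable on elements such as \<open>L\<close> and \<open>R\<close>.\<close>

lemma triality_eq_trial2: "A \<in> so8 \<Longrightarrow> triality A = (1/2) *\<^sub>R trial2 A"
  using is_triality_unique[OF is_triality_triality is_triality_trial2] .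

lemma triality_add: "A \<in> so8 \<Longrightarrow> B \<in> so8 \<Longrightarrow> triality (A + B) = triality A + triality B"
  by (simp add: triality_eq_trial2 so8_closed trial2_linear scaleR_add_right)

lemma triality_scaleR: "A \<in> so8 \<Longrightarrow> triality (c *\<^sub>R A) = c *\<^sub>R triality A"
  by (simp add: triality_eq_trial2 so8_closed trial2_linear)

lemma triality_0: "triality 0 = 0"
  using triality_scaleR[OF so8_closed(1), of 0] by simp

lemma L1_in_t2: "L1 \<in> t2" and R1_in_t2: "R1 \<in> t2"
  by (simp_all add: t2_def span_base)

lemma t2_combination: "t *\<^sub>R L1 + s *\<^sub>R R1 \<in> t2"
  by (simp add: t2_def span_add span_scale span_base)

lemma L1_so8: "L1 \<in> so8" and R1_so8: "R1 \<in> so8"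
  using t2_subset_so8 L1_in_t2 R1_in_t2 by auto

lemma oct_R_e1_nth: "R1 $ i $ j = (oct_e j \<odot> oct_e 1) $ i"
  by (simp add: oct_R_def matrix_def oct_e_def)

lemma triality_L1: "triality L1 = R1"
  by (simp add: triality_eq_trial2 L1_so8 vec_eq_iff forall_8 trial2_nth oct_L_nth
      oct_R_e1_nth oct_mult_e oct_e_nth)

lemma triality_R1: "triality R1 = - (L1 + R1)"
  by (simp add: triality_eq_trial2 R1_so8 vec_eq_iff forall_8 trial2_nth oct_L_nth
      oct_R_e1_nth oct_mult_e oct_e_nth)

text \<open>In the basis \<open>(L, R)\<close> of the torus, triality is the integral matrix of order three with
  columns \<open>(0, 1)\<close> and \<open>(-1, -1)\<close>.\<close>

lemma triality_t2: "triality (t *\<^sub>R L1 + s *\<^sub>R R1) = (- s) *\<^sub>R L1 + (t - s) *\<^sub>R R1"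
  by (simp add: triality_add triality_scaleR L1_so8 R1_so8 so8_closed triality_L1 triality_R1
      algebra_simps)

text \<open>\<open>L\<close> and \<open>R\<close> agree on \<open>\<complex>\<close> and are opposite on its orthogonal complement, as \<open>e\<^sub>1\<close> anticommutes
  with the other imaginary units; hence only the rotation of \<open>\<complex>\<close> survives in their sum.\<close>

lemma wedge_e0_e1: "wedge (oct_e 0) (oct_e 1) = (- (1/2)) *\<^sub>R L1 + (- (1/2)) *\<^sub>R R1"
  by (simp add: vec_eq_iff forall_8 wedge_nth oct_L_nth oct_R_e1_nth oct_mult_e oct_e_nth)


section \<open>The operations on pure tensors\<close>

lemma outer_add_left: "outer (a + b) c = outer a c + outer b c"
  by (simp add: outer_def vec_eq_iff algebra_simps)

lemma outer_diff_left: "outer (a - b) c = outer a c - outer b c"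
  by (simp add: outer_def vec_eq_iff algebra_simps)

lemma outer_scaleR_left: "outer (k *\<^sub>R a) c = k *\<^sub>R outer a c"
  by (simp add: outer_def vec_eq_iff)

lemma outer_scaleR_right: "outer a (k *\<^sub>R c) = k *\<^sub>R outer a c"
  by (simp add: outer_def vec_eq_iff)

lemma outer_minus_right: "outer a (- c) = - outer a c"
  by (simp add: outer_def vec_eq_iff)

lemma outer_add_right: "outer a (b + c) = outer a b + outer a c"
  by (simp add: outer_def vec_eq_iff algebra_simps)

lemma outer_0_left: "outer 0 c = 0"
  by (simp add: outer_def vec_eq_iff)

lemma outer_mult_outer: "outer a b ** outer c d = (b \<bullet> c) *\<^sub>R outer a d"
  by (simp add: outer_def matrix_matrix_mult_def vec_eq_iff inner_vec_def sum_distrib_left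
      sum_distrib_right mult_ac)

lemma matrix_mult_outer: "M ** outer a b = outer (M *v a) b"
  by (simp add: outer_def matrix_matrix_mult_def matrix_vector_mult_def vec_eq_iff
      sum_distrib_left mult_ac)

lemma outer_mult_matrix: "outer a b ** M = outer a (b v* M)"
  by (simp add: outer_def matrix_matrix_mult_def vector_matrix_mult_def vec_eq_iff
      sum_distrib_left mult_ac)

lemma matrix_mult_zero: "0 ** M = 0" "M ** 0 = 0" for M :: mat8
  by (simp_all add: vec_eq_iff matrix_matrix_mult_def)

lemma mult_transpose_outer_0: "M ** transpose (outer 0 c) = 0"
  by (simp add: transpose_def outer_def vec_eq_iff matrix_matrix_mult_def)

lemma trace_outer: "trace (outer a b) = a \<bullet> b"
  by (simp add: trace_def outer_def inner_vec_def)

lemma trace_zero: "trace (0 :: mat8) = 0"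
  by (simp add: trace_def)

lemma oct_e_inner: "oct_e i \<bullet> oct_e j = of_bool (i = j)"
  by (simp add: oct_e_def inner_axis_axis)

text \<open>The first component contains \<open>\<langle>e\<^sub>0, e\<^sub>1\<rangle>\<close> as a factor; in the second, \<open>u\<close> and \<open>x\<close> are contracted
  instead.\<close>

lemma curly_wedge_tensor_e0_e1:
  "curly_wedge (outer u (oct_e 0)) (outer x (oct_e 1)) = (0, (u \<bullet> x) *\<^sub>R wedge (oct_e 0) (oct_e 1))"
  by (simp add: curly_wedge_def transpose_outer outer_mult_outer oct_e_inner wedge_def
      inner_commute scaleR_diff_right)

text \<open>A torus element sends the row vector \<open>e\<^sub>0\<^sup>t\<close> to minus the transpose of its value at \<open>e\<^sub>0\<close>, because it
  is skew; and \<open>L\<close>, \<open>R\<close> have the same value \<open>e\<^sub>1\<close> there.\<close>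

lemma tensor_e0_mult_t2:
  "outer u (oct_e 0) ** (t *\<^sub>R L1 + s *\<^sub>R R1) = - outer ((t + s) *\<^sub>R u) (oct_e 1)"
proof -
  have "oct_e 0 v* (t *\<^sub>R L1 + s *\<^sub>R R1) = (- (t + s)) *\<^sub>R oct_e 1"
    by (simp add: vec_eq_iff forall_8 vector_matrix_mult_def sum_8 oct_L_nth oct_R_e1_nth
        oct_mult_e oct_e_nth)
  then show ?thesis
    by (simp only: outer_mult_matrix outer_scaleR_right outer_scaleR_left scaleR_minus_left
        outer_minus_right)
qed

lemma oo_cnj_mult_tensor_e0_e1:
  "oo_cnj (outer v (oct_e 0) \<star> outer z (oct_e 1)) = - outer (oct_cnj (v \<odot> z)) (oct_e 1)"
  "oo_cnj (outer y (oct_e 1) \<star> outer w (oct_e 0)) = - outer (oct_cnj (y \<odot> w)) (oct_e 1)"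
  by (simp_all add: oo_mult_outer oo_cnj_outer oct_products oct_cnj_e outer_minus_right)


section \<open>The orthogonal complement\<close>

lemma OC_eq: "OC = {outer a (oct_e 0) + outer b (oct_e 1) | a b. True}" (is "_ = ?S")
proof
  show "OC \<subseteq> ?S"
    unfolding OC_def
  proof (rule span_minimal)
    show "{outer x c | x c. c \<in> oct_C} \<subseteq> ?S"
    proof clarify
      fix x c assume "c \<in> oct_C"
      then obtain p q where "c = p *\<^sub>R oct_e 0 + q *\<^sub>R oct_e 1"
        unfolding oct_C_def by (auto simp: span_breakdown_eq algebra_simps)
      then have "outer x c = outer (p *\<^sub>R x) (oct_e 0) + outer (q *\<^sub>R x) (oct_e 1)"
        by (simp add: outer_add_right outer_scaleR_right outer_scaleR_left)
      then show "\<exists>a b. outer x c = outer a (oct_e 0) + outer b (oct_e 1) \<and> True" by blast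
    qed
    show "subspace ?S"
      unfolding subspace_def
    proof (intro conjI ballI allI)
      show "0 \<in> ?S" using outer_0_left by (metis (mono_tags, lifting) add_0 mem_Collect_eq)
    next
      fix X Y assume "X \<in> ?S" "Y \<in> ?S"
      then obtain a b c d where
        "X = outer a (oct_e 0) + outer b (oct_e 1)" "Y = outer c (oct_e 0) + outer d (oct_e 1)"
        by blast
      then have "X + Y = outer (a + c) (oct_e 0) + outer (b + d) (oct_e 1)"
        by (simp add: outer_add_left)
      then show "X + Y \<in> ?S" by blast
    next
      fix k X assume "X \<in> ?S"
      then obtain a b where "X = outer a (oct_e 0) + outer b (oct_e 1)" by blast
      then have "k *\<^sub>R X = outer (k *\<^sub>R a) (oct_e 0) + outer (k *\<^sub>R b) (oct_e 1)"
        by (simp add: outer_scaleR_left scaleR_add_right)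
      then show "k *\<^sub>R X \<in> ?S" by blast
    qed
  qed
  have "outer a (oct_e 0) \<in> OC" "outer b (oct_e 1) \<in> OC" for a b
    unfolding OC_def oct_C_def by (blast intro: span_base)+
  then show "?S \<subseteq> OC" by (auto simp: OC_def intro: span_add)
qed

lemma tensor_e1_in_OC: "outer b (oct_e 1) \<in> OC"
  unfolding OC_eq using outer_0_left by (metis (mono_tags, lifting) add_0 mem_Collect_eq)

lemma matrix_add_mult_distrib: "(A + B) ** C = A ** C + B ** C" for A B C :: mat8
  by (simp add: vec_eq_iff matrix_matrix_mult_def algebra_simps sum.distrib)

lemma trace_OC_tensor_e0:
  "trace ((outer a (oct_e 0) + outer b (oct_e 1)) ** transpose (outer u (oct_e 0))) = a \<bullet> u"
  by (simp add: transpose_outer matrix_add_mult_distrib outer_mult_outer oct_e_inner trace_outer)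

lemma trace_tensor_e1_e0: "trace (outer b (oct_e 1) ** transpose (outer u (oct_e 0))) = 0"
  by (simp add: transpose_outer outer_mult_outer oct_e_inner trace_outer trace_def)

lemma OC_orthogonal_tensors_e0:
  assumes "X \<in> OC" and "\<And>u. trace (X ** transpose (outer u (oct_e 0))) = 0"
  shows "X \<in> range (\<lambda>x. outer x (oct_e 1))"
proof -
  obtain a b where X: "X = outer a (oct_e 0) + outer b (oct_e 1)"
    using assms(1) unfolding OC_eq by blast
  have "a \<bullet> a = 0" using assms(2)[of a] by (simp only: X trace_OC_tensor_e0)
  then show ?thesis by (simp add: X outer_0_left)
qed

lemma trace_so8_square:
  assumes "A \<in> so8"
  shows "- trace (A ** A) = A \<bullet> A"
proof -
  have "trace (A ** A) = trace (A ** (- transpose A))"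
    using assms by (simp add: so8_def)
  also have "\<dots> = - (A \<bullet> A)"
    by (simp add: trace_def matrix_matrix_mult_def transpose_def inner_vec_def sum_negf)
  finally show ?thesis by simp
qed

lemma f4_perp_eq:
  "f4_perp = ({0} \<times> t2) \<times> range (\<lambda>x. outer x (oct_e 1))
     \<times> range (\<lambda>x. outer x (oct_e 1)) \<times> range (\<lambda>x. outer x (oct_e 1))" (is "_ = ?V")
proof
  show "f4_perp \<subseteq> ?V"
  proof
    fix Z assume Z: "Z \<in> f4_perp"
    obtain A B X Y W where eq: "Z = ((A, B), X, Y, W)" by (metis prod.exhaust)
    have mem: "A \<in> so8" "B \<in> t2" "X \<in> OC" "Y \<in> OC" "W \<in> OC"
      using Z by (auto simp: f4_perp_def e6_def eq)
    have orth: "8 * trace (X ** transpose (outer u (oct_e 0)) + Y ** transpose (outer v (oct_e 0))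
        + W ** transpose (outer w (oct_e 0))) - trace (A ** C) = 0" if "C \<in> so8" for C u v w
    proof -
      have "f4_embed (C, u, v, w) \<in> f4" unfolding f4_def using that by (intro imageI) simp
      then have "e8_inner Z (f4_embed (C, u, v, w)) = 0" using Z by (auto simp: f4_perp_def)
      then show ?thesis by (simp add: eq trace_zero matrix_mult_zero)
    qed
    \<comment> \<open>The \<open>so(8)\<close> part is tested against itself, as the trace form is definite on \<open>so(8)\<close>.\<close>
    have "trace (A ** A) = 0"
      using orth[OF mem(1), of 0 0 0] by (simp add: mult_transpose_outer_0 trace_zero)
    then have "A = 0" using trace_so8_square[OF mem(1)] by simp
    moreover have "X \<in> range (\<lambda>x. outer x (oct_e 1))"
      using mem(3) orth[OF so8_closed(1), of _ 0 0]
      by (intro OC_orthogonal_tensors_e0) (simp_all add: mult_transpose_outer_0 trace_zero)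
    moreover have "Y \<in> range (\<lambda>x. outer x (oct_e 1))"
      using mem(4) orth[OF so8_closed(1), of 0 _ 0]
      by (intro OC_orthogonal_tensors_e0) (simp_all add: mult_transpose_outer_0 trace_zero)
    moreover have "W \<in> range (\<lambda>x. outer x (oct_e 1))"
      using mem(5) orth[OF so8_closed(1), of 0 0]
      by (intro OC_orthogonal_tensors_e0) (simp_all add: mult_transpose_outer_0 trace_zero)
    ultimately show "Z \<in> ?V" using mem(2) by (simp add: eq)
  qed
  show "?V \<subseteq> f4_perp"
    by (auto simp: f4_perp_def e6_def f4_def so8_closed tensor_e1_in_OC trace_add
        trace_tensor_e1_e0 trace_zero matrix_mult_zero)
qed


section \<open>The coordinates on the complement\<close>

lemma linear_f4_perp_iso: "linear f4_perp_iso"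
  by (simp add: linear_iff scaleR_add_left scaleR_add_right outer_add_left outer_scaleR_left)

text \<open>Evaluating \<open>tL + sR = 0\<close> at \<open>e\<^sub>0\<close> gives \<open>t + s = 0\<close> and evaluating it at \<open>e\<^sub>2\<close>, which anticommutes
  with \<open>e\<^sub>1\<close>, gives \<open>t - s = 0\<close>.\<close>

lemma L1_R1_independent:
  assumes "t *\<^sub>R L1 + s *\<^sub>R R1 = t' *\<^sub>R L1 + s' *\<^sub>R R1"
  shows "t = t'" "s = s'"
proof -
  have "(t *\<^sub>R L1 + s *\<^sub>R R1) $ i $ j = (t' *\<^sub>R L1 + s' *\<^sub>R R1) $ i $ j" for i j
    by (simp only: assms)
  from this[of 1 0] this[of 3 2] show "t = t'" "s = s'"
    by (simp_all add: oct_L_nth oct_R_e1_nth oct_mult_e oct_e_nth)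
qed

lemma outer_e1_inject: "outer a (oct_e 1) = outer b (oct_e 1) \<longleftrightarrow> a = b"
proof
  assume "outer a (oct_e 1) = outer b (oct_e 1)"
  then have "outer a (oct_e 1) $ i $ 1 = outer b (oct_e 1) $ i $ 1" for i by simp
  then show "a = b" by (simp add: outer_def oct_e_nth vec_eq_iff)
qed simp

lemma bij_betw_f4_perp_iso: "bij_betw f4_perp_iso UNIV f4_perp"
  unfolding bij_betw_def
proof
  show "inj f4_perp_iso"
    by (rule injI) (auto simp: outer_e1_inject dest: L1_R1_independent)
  have "Z \<in> range f4_perp_iso" if "Z \<in> f4_perp" for Z
  proof -
    obtain A B X Y W where eq: "Z = ((A, B), X, Y, W)" by (metis prod.exhaust)
    with that have "A = 0" and B: "B \<in> t2" and "X \<in> range (\<lambda>x. outer x (oct_e 1))"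
      "Y \<in> range (\<lambda>x. outer x (oct_e 1))" "W \<in> range (\<lambda>x. outer x (oct_e 1))"
      unfolding f4_perp_eq by simp_all
    then obtain x y z
      where Z: "Z = ((0, B), outer x (oct_e 1), outer y (oct_e 1), outer z (oct_e 1))"
      using eq by blast
    obtain t s where "B = t *\<^sub>R L1 + s *\<^sub>R R1"
      using B unfolding t2_def by (auto simp: span_breakdown_eq algebra_simps)
    then have "Z = f4_perp_iso (t, s, x, y, z)" by (simp add: Z)
    then show ?thesis by blast
  qed
  moreover have "f4_perp_iso p \<in> f4_perp" for p
    by (cases p) (simp add: f4_perp_eq t2_combination)
  ultimately show "range f4_perp_iso = f4_perp" by blast
qed


section \<open>The bracket\<close>

lemma Triality_torus: "Triality (0, t *\<^sub>R L1 + s *\<^sub>R R1) = (0, (- s) *\<^sub>R L1 + (t - s) *\<^sub>R R1)"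
  by (simp only: Triality_def map_prod_simp triality_0 triality_t2)

lemma Triality_fst: "Triality (A, 0) = (triality A, 0)"
  by (simp add: Triality_def triality_0)

lemma curly_wedge_torus:
  "curly_wedge (outer u (oct_e 0)) (outer x (oct_e 1)) =
    (0, (- (u \<bullet> x) / 2) *\<^sub>R L1 + (- (u \<bullet> x) / 2) *\<^sub>R R1)"
  by (simp add: curly_wedge_tensor_e0_e1 wedge_e0_e1 scaleR_add_right scaleR_diff_right)

lemma e8_bracket_f4_perp:
  "e8_bracket (f4_embed (A, u, v, w)) (f4_perp_iso (t, s, x, y, z)) =
     f4_perp_iso
       (2 * (u \<bullet> x) - 2 * (w \<bullet> z),
        2 * (u \<bullet> x) - 2 * (v \<bullet> y),
        A *v x - (t + s) *\<^sub>R u - oct_cnj (v \<odot> z) + oct_cnj (y \<odot> w),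
        triality A *v y - (t - 2 * s) *\<^sub>R v - oct_cnj (w \<odot> x) + oct_cnj (z \<odot> u),
        triality (triality A) *v z - (s - 2 * t) *\<^sub>R w - oct_cnj (u \<odot> y) + oct_cnj (x \<odot> v))"
proof -
  let ?T = "\<lambda>t s. t *\<^sub>R L1 + s *\<^sub>R R1"
  have torus: "pair_bracket (A, 0) (0, ?T t s)
        - 4 *\<^sub>R curly_wedge (outer u (oct_e 0)) (outer x (oct_e 1))
        - 4 *\<^sub>R Triality (Triality (curly_wedge (outer v (oct_e 0)) (outer y (oct_e 1))))
        - 4 *\<^sub>R Triality (curly_wedge (outer w (oct_e 0)) (outer z (oct_e 1)))
      = (0, ?T (2 * (u \<bullet> x) - 2 * (w \<bullet> z)) (2 * (u \<bullet> x) - 2 * (v \<bullet> y)))"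
    by (simp only: curly_wedge_torus Triality_torus) (simp add: mat_bracket_def algebra_simps)
  have act: "pair_act (P, 0) (outer a (oct_e 1)) - pair_act (0, ?T p q) (outer b (oct_e 0)) =
      outer (P *v a - (p + q) *\<^sub>R b) (oct_e 1)" for P a b p q
    by (simp add: matrix_mult_outer tensor_e0_mult_t2 outer_diff_left outer_0_left)
  have coeff: "- s + (t - s) = t - 2 * s" "- (t - s) + (- s - (t - s)) = s - 2 * t" by simp_all
  show ?thesis
    by (simp only: f4_embed.simps f4_perp_iso.simps e8_bracket.simps torus Triality_fst
        Triality_torus act coeff oo_cnj_mult_tensor_e0_e1)
      (simp add: outer_add_left outer_diff_left)
qed

theorem lemma5p2:
  shows "f4_perp = ({0} \<times> t2) \<times> range (\<lambda>x. outer x (oct_e 1))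
           \<times> range (\<lambda>x. outer x (oct_e 1)) \<times> range (\<lambda>x. outer x (oct_e 1))
    \<and> linear f4_perp_iso \<and> bij_betw f4_perp_iso UNIV f4_perp
    \<and> (\<forall>A\<in>so8. \<forall>u v w t s x y z.
         e8_bracket (f4_embed (A, u, v, w)) (f4_perp_iso (t, s, x, y, z)) =
         f4_perp_iso
           (2 * (u \<bullet> x) - 2 * (w \<bullet> z),
            2 * (u \<bullet> x) - 2 * (v \<bullet> y),
            A *v x - (t + s) *\<^sub>R u - oct_cnj (v \<odot> z) + oct_cnj (y \<odot> w),
            triality A *v y - (t - 2 * s) *\<^sub>R v - oct_cnj (w \<odot> x) + oct_cnj (z \<odot> u),
            triality (triality A) *v z - (s - 2 * t) *\<^sub>R w - oct_cnj (u \<odot> y) + oct_cnj (x \<odot> v)))"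
  using f4_perp_eq linear_f4_perp_iso bij_betw_f4_perp_iso e8_bracket_f4_perp by blast

end
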